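(* Let $\varphi$ be a bounded Markovian random iteration associated with the pair $(p,m)$ and a measurable map $f\colon E\times M\to M$, where $E$, $M$ are standard measurable spaces and $m$ is the unique stationary probability measure of $p$. Then a stationary measure $\nu\in \mathcal{S}(\varphi)$ is ergodic if and only if the $\varphi$-invariant measure $\Xi(\nu)$ is ergodic.
   Context: Setting. $(E,\mathscr{E})$ and $(M,\mathscr{B})$ are standard measurable (standard Borel) spaces. $p\colon E\times\mathscr{E}\to[0,1]$ is a transition probability with a unique stationary probability measure $m$, i.e. $m(A)=\int p(\alpha,A)\,dm(\alpha)$ for all $A\in\mathscr{E}$. $\Sigma=E^{\mathbb{N}}$ (indices $0,1,2,\dots$) carries the product $\sigma$-algebra, and $\mathbb{P}$ is the Markov measure on $\Sigma$ associated with $(p,m)$ (the coordinates $\omega_n$ form a Markov chain with transition probability $p$ and initial law $m$). $\sigma$ is the shift on $\Sigma$. $f\colon E\times M\to M$ is measurable, $f_\alpha(x)=f(\alpha,x)$; the Markovian random iteration is $\varphi(n,\omega,x)=f^n_\omega(x)=f_{\omega_{n-1}}\circ\dots\circ f_{\omega_0}(x)$; the skew product is $F(\omega,x)=(\sigma(\omega),f_{\omega_0}(x))$ on $\Sigma\times M$. Bounded. Write $p_\alpha=p(\alpha,\cdot)$. The pair $(p,m)$ (and $\varphi$) is bounded if $p_\alpha\ll m$ for every $\alpha$ and there is a constant $0<C\le1$ with $C\le \frac{dp_\alpha}{dm}(\beta)\le C^{-1}$ for every $\alpha,\beta\in E$. $\mathcal{S}(\varphi)$ is the set of stationary probability measures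 $\nu$ on $E\times M$ of the transition probability $\hat p((\alpha,x),B)=\int \mathbf{1}_B(\beta,f_\beta(x))\,p(\alpha,d\beta)$. Every such $\nu$ has first marginal $m$ and hence a disintegration $\{\nu_\alpha\}$ with respect to $m$: $\nu(A\times B)=\int_A\nu_\alpha(B)\,dm(\alpha)$. A $\varphi$-invariant measure is an $F$-invariant probability measure on $\Sigma\times M$ with first marginal $\mathbb{P}$. $I_0(\varphi)$ is the set of $\varphi$-invariant measures whose disintegration with respect to $\mathbb{P}$ has the form $\hat\mu_\omega=\mu_{\omega_0}$ for some family $\{\mu_\alpha\}_{\alpha\in E}$ of probability measures on $M$. Let $q$ be the transition probability on $E$ in duality with $p$ relative to $m$: $\int_B p(\alpha,A)\,dm(\alpha)=\int_A q(\beta,B)\,dm(\beta)$ for all $A,B\in\mathscr{E}$ (it exists and is essentially unique). $\Xi\colon \mathcal{S}(\varphi)\to I_0(\varphi)$ is the bijection sending $\nu$ to the measure $\hat\mu$ with first marginal $\mathbb{P}$ and disintegration $\hat\mu_\omega=\int\nu_\beta\,q(\omega_0,d\beta)$. Ergodicity (standard notions). $\nu\in\mathcal{S}(\varphi)$ is ergodic if every measurable $B\subset E\times M$ with $\hat p(\cdot,B)=\mathbf{1}_B$ $\nu$-a.e. satisfies $\nu(B)\in\{0,1\}$. An $F$-invariant probability measure $\hat\mu$ is ergodic if every measurable $A$ with $F^{-1}(A)=A$ satisfies $\hat\mu(A)\in\{0,1\}$. *)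

theory Defs
  imports "HOL-Probability.Probability"
begin

text \<open>
  Measurable spaces are given by the \<open>space\<close> and \<open>sets\<close> of a measure, as usual in the library;
  a transition probability on \<open>E\<close> is an element of \<open>E \<rightarrow>\<^sub>M prob_algebra E\<close>.
\<close>

definition standard_borel :: "'a measure \<Rightarrow> bool" where
  "standard_borel X \<longleftrightarrow>
     (\<exists>T. completely_metrizable_space T \<and> separable_space T \<and>
          space X = topspace T \<and> sets X = sigma_sets (topspace T) {U. openin T U})"

definition stationary :: "'a measure \<Rightarrow> ('a \<Rightarrow> 'a measure) \<Rightarrow> 'a measure \<Rightarrow> bool" where
  "stationary X K \<nu> \<longleftrightarrow>
     \<nu> \<in> space (prob_algebra X) \<and>
     (\<forall>A\<in>sets X. emeasure \<nu> A = (\<integral>\<^sup>+x. emeasure (K x) A \<partial>\<nu>))"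

definition ergodic_stationary :: "'a measure \<Rightarrow> ('a \<Rightarrow> 'a measure) \<Rightarrow> 'a measure \<Rightarrow> bool" where
  "ergodic_stationary X K \<nu> \<longleftrightarrow>
     stationary X K \<nu> \<and>
     (\<forall>B\<in>sets X. (AE x in \<nu>. emeasure (K x) B = indicator B x) \<longrightarrow> emeasure \<nu> B \<in> {0, 1})"

definition ergodic_invariant :: "'a measure \<Rightarrow> ('a \<Rightarrow> 'a) \<Rightarrow> 'a measure \<Rightarrow> bool" where
  "ergodic_invariant X T \<mu> \<longleftrightarrow>
     \<mu> \<in> space (prob_algebra X) \<and> T \<in> X \<rightarrow>\<^sub>M X \<and> distr \<mu> X T = \<mu> \<and>
     (\<forall>A\<in>sets X. T -` A \<inter> space X = A \<longrightarrow> emeasure \<mu> A \<in> {0, 1})"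

text \<open>
  A Radon-Nikodym derivative is only determined up to \<open>m\<close>-null sets, so the bounds on
  \<open>dp\<^sub>\<alpha>/dm\<close> are required for every \<open>\<alpha>\<close> and \<open>m\<close>-almost every \<open>\<beta>\<close>; equivalently, for every \<open>\<alpha>\<close>
  some version of the derivative satisfies them everywhere.
\<close>

definition bounded_pair :: "'e measure \<Rightarrow> ('e \<Rightarrow> 'e measure) \<Rightarrow> 'e measure \<Rightarrow> bool" where
  "bounded_pair E p m \<longleftrightarrow>
     (\<forall>\<alpha>\<in>space E. absolutely_continuous m (p \<alpha>)) \<and>
     (\<exists>C::real. 0 < C \<and> C \<le> 1 \<and>
        (\<forall>\<alpha>\<in>space E. AE \<beta> in m.
           ennreal C \<le> RN_deriv m (p \<alpha>) \<beta> \<and> RN_deriv m (p \<alpha>) \<beta> \<le> ennreal (1 / C)))"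

definition dual_kernel ::
  "'e measure \<Rightarrow> ('e \<Rightarrow> 'e measure) \<Rightarrow> 'e measure \<Rightarrow> ('e \<Rightarrow> 'e measure) \<Rightarrow> bool" where
  "dual_kernel E p m q \<longleftrightarrow>
     q \<in> E \<rightarrow>\<^sub>M prob_algebra E \<and>
     (\<forall>A\<in>sets E. \<forall>B\<in>sets E.
        (\<integral>\<^sup>+\<alpha>\<in>B. emeasure (p \<alpha>) A \<partial>m) = (\<integral>\<^sup>+\<beta>\<in>A. emeasure (q \<beta>) B \<partial>m))"

text \<open>
  Ionescu-Tulcea extension of the step kernels: coordinate \<open>0\<close> has law \<open>m\<close>, and coordinate
  \<open>Suc k\<close> has law \<open>p (\<omega> k)\<close> given the coordinates \<open>0, \<dots>, k\<close>.
\<close>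

definition markov_step :: "('e \<Rightarrow> 'e measure) \<Rightarrow> 'e measure \<Rightarrow> nat \<Rightarrow> (nat \<Rightarrow> 'e) \<Rightarrow> 'e measure" where
  "markov_step p m n \<omega> = (case n of 0 \<Rightarrow> m | Suc k \<Rightarrow> p (\<omega> k))"

definition markov_measure :: "('e \<Rightarrow> 'e measure) \<Rightarrow> 'e measure \<Rightarrow> (nat \<Rightarrow> 'e) measure" where
  "markov_measure p m =
     projective_family.lim UNIV (Ionescu_Tulcea.CI (markov_step p m) (\<lambda>_. m)) (\<lambda>_. m)"

lemma Ionescu_Tulcea_markov_step:
  assumes "p \<in> E \<rightarrow>\<^sub>M prob_algebra E" and "m \<in> space (prob_algebra E)"
  shows "Ionescu_Tulcea (markov_step p m) (\<lambda>_. m)"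
proof -
  have E: "sets m = sets E" and "prob_space m"
    using assms(2) by (auto simp: space_prob_algebra)
  have "prob_algebra m = prob_algebra E"
    using subprob_algebra_cong[OF E] by (simp add: prob_algebra_def)
  with assms(1) have p: "p \<in> m \<rightarrow>\<^sub>M prob_algebra m"
    by (simp add: measurable_cong_sets[OF E refl])
  have m: "m \<in> space (prob_algebra m)"
    using \<open>prob_space m\<close> by (simp add: space_prob_algebra)
  have step: "markov_step p m i \<in> PiM {0..<i} (\<lambda>_. m) \<rightarrow>\<^sub>M prob_algebra m" for i
  proof (cases i)
    case 0
    then have "markov_step p m i = (\<lambda>_. m)"
      by (simp add: fun_eq_iff markov_step_def)
    then show ?thesis using m by simp
  next
    case (Suc k)
    have "(\<lambda>\<omega>. \<omega> k) \<in> PiM {0..<i} (\<lambda>_. m) \<rightarrow>\<^sub>M m"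
      using Suc by (intro measurable_component_singleton) auto
    from measurable_compose[OF this p] Suc show ?thesis
      by (simp add: markov_step_def[abs_def])
  qed
  show ?thesis
  proof (rule Ionescu_Tulcea.intro)
    show "markov_step p m i \<in> PiM {0..<i} (\<lambda>_. m) \<rightarrow>\<^sub>M subprob_algebra m" for i
      by (rule measurable_prob_algebraD[OF step])
    show "prob_space (markov_step p m i x)" if "x \<in> space (PiM {0..<i} (\<lambda>_. m))" for i x
      using measurable_space[OF step that] by (simp add: space_prob_algebra)
  qed
qed

definition skew_product ::
  "('e \<Rightarrow> 'm \<Rightarrow> 'm) \<Rightarrow> (nat \<Rightarrow> 'e) \<times> 'm \<Rightarrow> (nat \<Rightarrow> 'e) \<times> 'm" where
  "skew_product f = (\<lambda>(\<omega>, x). (\<lambda>n. \<omega> (Suc n), f (\<omega> 0) x))"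

definition p_hat ::
  "'e measure \<Rightarrow> 'm measure \<Rightarrow> ('e \<Rightarrow> 'e measure) \<Rightarrow> ('e \<Rightarrow> 'm \<Rightarrow> 'm) \<Rightarrow> 'e \<times> 'm \<Rightarrow> ('e \<times> 'm) measure" where
  "p_hat E M p f = (\<lambda>(\<alpha>, x). distr (p \<alpha>) (E \<Otimes>\<^sub>M M) (\<lambda>\<beta>. (\<beta>, f \<beta> x)))"

definition disintegration ::
  "'a measure \<Rightarrow> 'm measure \<Rightarrow> ('a \<times> 'm) measure \<Rightarrow> ('a \<Rightarrow> 'm measure) \<Rightarrow> bool" where
  "disintegration N M \<mu> \<kappa> \<longleftrightarrow>
     sets \<mu> = sets (N \<Otimes>\<^sub>M M) \<and> \<kappa> \<in> N \<rightarrow>\<^sub>M prob_algebra M \<and>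
     (\<forall>A\<in>sets N. \<forall>B\<in>sets M. emeasure \<mu> (A \<times> B) = (\<integral>\<^sup>+a\<in>A. emeasure (\<kappa> a) B \<partial>N))"

text \<open>
  The measure \<open>\<integral> \<nu>\<^sub>\<beta> q(\<omega>\<^sub>0, d\<beta>)\<close> is \<open>q (\<omega> 0) \<bind> \<kappa>\<close> for a disintegration \<open>\<kappa>\<close> of \<open>\<nu>\<close>. The resulting
  measure does not depend on the choice of \<open>\<kappa>\<close>, as \<open>q (\<omega> 0)\<close> is almost surely absolutely
  continuous with respect to \<open>m\<close>.
\<close>

definition Xi ::
  "'m measure \<Rightarrow> ('e \<Rightarrow> 'e measure) \<Rightarrow> 'e measure \<Rightarrow> ('e \<Rightarrow> 'e measure) \<Rightarrow>
   ('e \<times> 'm) measure \<Rightarrow> ((nat \<Rightarrow> 'e) \<times> 'm) measure" where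
  "Xi M p m q \<nu> =
     (THE \<mu>. \<exists>\<kappa>. disintegration m M \<nu> \<kappa> \<and>
                 disintegration (markov_measure p m) M \<mu> (\<lambda>\<omega>. q (\<omega> 0) \<bind> \<kappa>))"

end

theory Submission
  imports Defs
begin

text \<open>
  The skew product is, up to the choice of coordinates, the shift on the trajectories of the Markov
  chain with transition probability \<open>p_hat\<close>, and \<open>Xi \<nu>\<close> is the law of the stationary trajectory
  started from \<open>\<nu>\<close>. The theorem is therefore an instance of the classical fact that a stationary
  measure of a chain is ergodic if and only if the shift is ergodic for the trajectory measure.

  In more detail, let \<open>(\<alpha>, x)\<close> have law \<open>\<nu>\<close> and let \<open>\<omega>\<close> be a path whose first letter has law
  \<open>p \<alpha>\<close>. The states visited after time 0 are \<open>(\<omega> 0, f (\<omega> 0) x)\<close> and its successors, so they are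
  functions of \<open>(\<omega>, x)\<close>, and deleting the first of them is exactly the skew product. The joint law
  of \<open>(\<omega>, x)\<close> is called the lift of \<open>\<nu>\<close> here. The dual kernel \<open>q\<close> gives the law of \<open>\<alpha>\<close> given \<open>\<omega> 0\<close>;
  hence the law of \<open>x\<close> given \<open>\<omega>\<close> is the mixture \<open>\<integral> \<nu>\<^sub>\<beta> q(\<omega> 0, d\<beta>)\<close>, that is, the lift is \<open>Xi \<nu>\<close>
  (\<open>disintegration_lift\<close>, \<open>Xi_eq_lift\<close>). As \<open>Xi\<close> is a definite description, this also
  requires that \<open>\<nu>\<close> has a disintegration at all. It is written down explicitly: one step of the chain
  has a density with respect to \<open>\<nu> \<otimes> m\<close>, because \<open>p \<alpha> \<lless> m\<close>, and stationarity turns this density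
  into the conditional laws (\<open>disintegration_of_absolutely_continuous_kernel\<close>). That the first
  marginal of \<open>\<nu>\<close> is \<open>m\<close> follows from the uniqueness of \<open>m\<close>.

  If the lift is ergodic, then so is \<open>\<nu>\<close>: for a set \<open>B\<close> with \<open>p_hat z B = indicator B z\<close> almost surely, the
  trajectory almost surely stays in \<open>B\<close> or stays outside \<open>B\<close>, so the event that \<open>B\<close> is visited
  infinitely often is strictly invariant and has measure \<open>\<nu> B\<close>
  (\<open>stationary_ergodic_if_lift_ergodic\<close>).

  If \<open>\<nu>\<close> is ergodic and \<open>A\<close> is an invariant event, the probability of \<open>A\<close> for the trajectory from \<open>z\<close>
  is a bounded harmonic function of \<open>z\<close>. By stationarity its variance over one step integrates to 0,
  so its superlevel sets are invariant and it is almost surely a constant \<open>c\<close>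
  (\<open>AE_harmonic_function_constant\<close>, \<open>AE_trajectory_of_invariant_set\<close>). By the Markov property and the
  invariance of \<open>A\<close>, the probability of \<open>A\<close> is still \<open>c\<close> given any finite number of steps
  (\<open>AE_invariant_set_independent_of_cylinder\<close>). So \<open>A\<close> is independent of all cylinders, hence of
  itself: \<open>c = c * c\<close> (\<open>lift_ergodic_if_stationary_ergodic\<close>).
\<close>

section \<open>Semidirect products and disintegrations\<close>

lemma measure_eqI_rectangles:
  assumes P: "sets P = sets (A \<Otimes>\<^sub>M B)" and Q: "sets Q = sets (A \<Otimes>\<^sub>M B)" and "finite_measure P"
    and eq: "\<And>X Y. X \<in> sets A \<Longrightarrow> Y \<in> sets B \<Longrightarrow> emeasure P (X \<times> Y) = emeasure Q (X \<times> Y)"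
  shows "P = Q"
proof -
  have P_fin: "emeasure P (space A \<times> space B) \<noteq> \<infinity>"
    using \<open>finite_measure P\<close> by (simp add: finite_measure.emeasure_finite)
  show ?thesis
  proof (rule measure_eqI_generator_eq[OF Int_stable_pair_measure_generator[of A B], where \<Omega>="space A \<times> space B"
        and A="\<lambda>_. space A \<times> space B"])
    show "{X \<times> Y |X Y. X \<in> sets A \<and> Y \<in> sets B} \<subseteq> Pow (space A \<times> space B)"
      by (rule pair_measure_closed)
  qed (use P Q eq P_fin in \<open>auto simp: sets_pair_measure\<close>)
qed

text \<open>
  The law of a pair whose first component has law \<open>N\<close> and whose second component has law \<open>\<kappa> a\<close>
  given the value \<open>a\<close> of the first. Disintegrations and the duality of kernels are statements about
  such measures on rectangles; having the measure itself extends them to all integrands.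
\<close>
definition semidirect_product ::
  "'a measure \<Rightarrow> 'b measure \<Rightarrow> ('a \<Rightarrow> 'b measure) \<Rightarrow> ('a \<times> 'b) measure" where
  "semidirect_product N M \<kappa> = N \<bind> (\<lambda>a. distr (\<kappa> a) (N \<Otimes>\<^sub>M M) (Pair a))"

lemma prob_algebra_cong: "sets A = sets B \<Longrightarrow> prob_algebra A = prob_algebra B"
  unfolding prob_algebra_def by (simp cong: subprob_algebra_cong)

lemma measurable_attach_source:
  assumes "\<kappa> \<in> N \<rightarrow>\<^sub>M prob_algebra M"
  shows "(\<lambda>a. distr (\<kappa> a) (N \<Otimes>\<^sub>M M) (Pair a)) \<in> N \<rightarrow>\<^sub>M prob_algebra (N \<Otimes>\<^sub>M M)"
  by (rule measurable_distr_prob_space2[OF assms]) (auto simp: case_prod_beta')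

context
  fixes N :: "'a measure" and M :: "'b measure" and \<kappa> :: "'a \<Rightarrow> 'b measure"
  assumes N: "prob_space N" and \<kappa>: "\<kappa> \<in> N \<rightarrow>\<^sub>M prob_algebra M"
begin

lemma base_in_space: "N \<in> space (prob_algebra N)"
  using N by (simp add: space_prob_algebra)

lemma semidirect_product_in_space: "semidirect_product N M \<kappa> \<in> space (prob_algebra (N \<Otimes>\<^sub>M M))"
  unfolding semidirect_product_def space_prob_algebra
  using sets_bind'[OF base_in_space measurable_attach_source[OF \<kappa>]]
    prob_space_bind'[OF base_in_space measurable_attach_source[OF \<kappa>]] by simp

lemma sets_semidirect_product: "sets (semidirect_product N M \<kappa>) = sets (N \<Otimes>\<^sub>M M)"
  using semidirect_product_in_space by (simp add: space_prob_algebra)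

lemma prob_space_semidirect_product: "prob_space (semidirect_product N M \<kappa>)"
  using semidirect_product_in_space by (simp add: space_prob_algebra)

lemma nn_integral_semidirect_product:
  assumes [measurable]: "g \<in> borel_measurable (N \<Otimes>\<^sub>M M)"
  shows "(\<integral>\<^sup>+x. g x \<partial>semidirect_product N M \<kappa>) = (\<integral>\<^sup>+a. \<integral>\<^sup>+b. g (a, b) \<partial>\<kappa> a \<partial>N)"
proof -
  note \<kappa>' = measurable_prob_algebraD[OF \<kappa>]
  have "(\<integral>\<^sup>+x. g x \<partial>semidirect_product N M \<kappa>)
      = (\<integral>\<^sup>+a. \<integral>\<^sup>+x. g x \<partial>distr (\<kappa> a) (N \<Otimes>\<^sub>M M) (Pair a) \<partial>N)"
    unfolding semidirect_product_def
    by (rule nn_integral_bind[OF assms measurable_prob_algebraD[OF measurable_attach_source[OF \<kappa>]]])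
  also have "\<dots> = (\<integral>\<^sup>+a. \<integral>\<^sup>+b. g (a, b) \<partial>\<kappa> a \<partial>N)"
    by (intro nn_integral_cong nn_integral_distr)
       (auto simp: measurable_cong_sets[OF sets_kernel[OF \<kappa>'] refl])
  finally show ?thesis .
qed

lemma emeasure_semidirect_product_rectangle:
  assumes [measurable]: "A \<in> sets N" "B \<in> sets M"
  shows "emeasure (semidirect_product N M \<kappa>) (A \<times> B) = (\<integral>\<^sup>+a\<in>A. emeasure (\<kappa> a) B \<partial>N)"
proof -
  have "emeasure (semidirect_product N M \<kappa>) (A \<times> B)
      = (\<integral>\<^sup>+x. indicator (A \<times> B) x \<partial>semidirect_product N M \<kappa>)"
    by (subst nn_integral_indicator) (auto simp: sets_semidirect_product)
  also have "\<dots> = (\<integral>\<^sup>+a. \<integral>\<^sup>+b. indicator B b * indicator A a \<partial>\<kappa> a \<partial>N)"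
    by (simp add: nn_integral_semidirect_product indicator_times mult.commute)
  also have "\<dots> = (\<integral>\<^sup>+a\<in>A. emeasure (\<kappa> a) B \<partial>N)"
  proof (rule nn_integral_cong)
    fix a assume "a \<in> space N"
    then have [measurable_cong]: "sets (\<kappa> a) = sets M"
      by (rule sets_kernel[OF measurable_prob_algebraD[OF \<kappa>]])
    show "(\<integral>\<^sup>+b. indicator B b * indicator A a \<partial>\<kappa> a) = emeasure (\<kappa> a) B * indicator A a"
      by (subst nn_integral_multc) auto
  qed
  finally show ?thesis .
qed

text \<open>
  A measure with a prescribed disintegration is unique, because rectangles generate the product
  \<open>\<sigma>\<close>-algebra. This is what makes the definite description in \<open>Xi\<close> unambiguous.
\<close>
lemma disintegration_iff_semidirect_product:
  "disintegration N M \<mu> \<kappa> \<longleftrightarrow> \<mu> = semidirect_product N M \<kappa>"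
proof
  assume "disintegration N M \<mu> \<kappa>"
  then show "\<mu> = semidirect_product N M \<kappa>"
    unfolding disintegration_def
    by (intro measure_eqI_rectangles[symmetric] prob_space.finite_measure prob_space_semidirect_product)
       (auto simp: sets_semidirect_product emeasure_semidirect_product_rectangle)
qed (simp add: disintegration_def sets_semidirect_product \<kappa> emeasure_semidirect_product_rectangle)

end

lemma nn_integral_disintegration:
  assumes "prob_space N" and "disintegration N M \<mu> \<kappa>" and "g \<in> borel_measurable (N \<Otimes>\<^sub>M M)"
  shows "(\<integral>\<^sup>+x. g x \<partial>\<mu>) = (\<integral>\<^sup>+a. \<integral>\<^sup>+b. g (a, b) \<partial>\<kappa> a \<partial>N)"
proof -
  have \<kappa>: "\<kappa> \<in> N \<rightarrow>\<^sub>M prob_algebra M"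
    using assms(2) by (simp add: disintegration_def)
  then have "\<mu> = semidirect_product N M \<kappa>"
    using disintegration_iff_semidirect_product[OF assms(1)] assms(2) by blast
  then show ?thesis
    using nn_integral_semidirect_product[OF assms(1) \<kappa> assms(3)] by simp
qed

section \<open>Markov measures on the path space\<close>

abbreviation cylinder :: "'e measure \<Rightarrow> nat \<Rightarrow> (nat \<Rightarrow> 'e set) \<Rightarrow> (nat \<Rightarrow> 'e) set" where
  "cylinder E n A \<equiv> prod_emb UNIV (\<lambda>_. E) {..<n} (Pi\<^sub>E {..<n} A)"

lemma cylinder_iff:
  "\<omega> \<in> cylinder E n A \<longleftrightarrow> \<omega> \<in> space (PiM UNIV (\<lambda>_. E)) \<and> (\<forall>i<n. \<omega> i \<in> A i)"
  by (auto simp: prod_emb_def space_PiM PiE_iff)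

text \<open>
  Cylinders over an initial segment of the time axis are enough: a cylinder over an arbitrary finite
  set of times is constrained by the whole space at the missing times. The segment is taken nonempty,
  since the recursive formula below starts with one coordinate.
\<close>
lemma prod_emb_eq_cylinder:
  assumes "finite J"
  shows "\<exists>n. prod_emb UNIV (\<lambda>_. E) J (Pi\<^sub>E J A) = cylinder E (Suc n) (\<lambda>i. if i \<in> J then A i else space E)"
proof -
  obtain n where n: "J \<subseteq> {..<n}"
    using finite_nat_bounded[OF assms] by blast
  then have "J \<subseteq> {..<Suc n}" by force
  then show ?thesis
    by (intro exI[of _ n]) (force simp: prod_emb_def space_PiM PiE_iff)
qed

lemma sets_cylinder [measurable]:
  "(\<And>i. i < n \<Longrightarrow> A i \<in> sets E) \<Longrightarrow> cylinder E n A \<in> sets (PiM UNIV (\<lambda>_. E))"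
  by (intro sets_PiM_I) auto

lemma measure_eqI_cylinder:
  assumes "sets P = sets (PiM UNIV (\<lambda>_. E))" and "sets Q = sets (PiM UNIV (\<lambda>_. E))"
    and "finite_measure P"
    and "\<And>n A. (\<And>i. A i \<in> sets E) \<Longrightarrow> emeasure P (cylinder E (Suc n) A) = emeasure Q (cylinder E (Suc n) A)"
  shows "P = Q"
proof (rule measure_eqI_PiM_infinite[OF assms(1,2) _ assms(3)])
  fix A :: "nat \<Rightarrow> 'a set" and J :: "nat set"
  assume J: "finite J" and A: "\<And>i. i \<in> J \<Longrightarrow> A i \<in> sets E"
  obtain n where "prod_emb UNIV (\<lambda>_. E) J (Pi\<^sub>E J A) = cylinder E (Suc n) (\<lambda>i. if i \<in> J then A i else space E)"
    using prod_emb_eq_cylinder[OF J] by blast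
  then show "emeasure P (prod_emb UNIV (\<lambda>_. E) J (Pi\<^sub>E J A))
           = emeasure Q (prod_emb UNIV (\<lambda>_. E) J (Pi\<^sub>E J A))"
    using A by (simp add: assms(4))
qed

text \<open>
  The expectation of \<open>g\<close> at time \<open>n\<close> on the event that the chain started at \<open>\<beta>\<close> is in \<open>A i\<close> at each
  time \<open>i \<le> n\<close>. The recursion peels off the first step, whereas the Ionescu-Tulcea construction
  adds the last one. The test function \<open>g\<close> lets one reconcile the two: the last step can be absorbed
  into it.
\<close>
primrec path_weight ::
  "('e \<Rightarrow> 'e measure) \<Rightarrow> nat \<Rightarrow> (nat \<Rightarrow> 'e set) \<Rightarrow> ('e \<Rightarrow> ennreal) \<Rightarrow> 'e \<Rightarrow> ennreal" where
  "path_weight p 0 A g \<beta> = indicator (A 0) \<beta> * g \<beta>"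
| "path_weight p (Suc n) A g \<beta> =
     indicator (A 0) \<beta> * (\<integral>\<^sup>+\<gamma>. path_weight p n (\<lambda>i. A (Suc i)) g \<gamma> \<partial>p \<beta>)"

lemma path_weight_snoc:
  "path_weight p (Suc n) A g =
   path_weight p n A (\<lambda>\<beta>. \<integral>\<^sup>+\<gamma>. indicator (A (Suc n)) \<gamma> * g \<gamma> \<partial>p \<beta>)"
proof (induction n arbitrary: A)
  case (Suc n)
  show ?case by (rule ext) (simp only: path_weight.simps(2)[of p "Suc n"] path_weight.simps(2)[of p n] Suc)
qed auto

locale transition_kernel =
  fixes E :: "'e measure" and p :: "'e \<Rightarrow> 'e measure"
  assumes kernel: "p \<in> E \<rightarrow>\<^sub>M prob_algebra E"
begin

lemmas kernel_subprob [measurable] = measurable_prob_algebraD[OF kernel]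

abbreviation paths :: "(nat \<Rightarrow> 'e) measure" where
  "paths \<equiv> PiM UNIV (\<lambda>_. E)"

lemma measurable_path_weight [measurable]:
  assumes "g \<in> borel_measurable E" and "\<And>i. A i \<in> sets E"
  shows "path_weight p n A g \<in> borel_measurable E"
  using assms
proof (induction n arbitrary: A)
  case (Suc n)
  note [measurable] = Suc
  show ?case unfolding path_weight.simps(2)[abs_def]
    using Suc by measurable
next
  case 0
  note [measurable] = 0
  show ?case unfolding path_weight.simps(1)[abs_def] by measurable
qed

context
  fixes l :: "'e measure"
  assumes l: "l \<in> space (prob_algebra E)"
begin

interpretation IT: Ionescu_Tulcea "markov_step p l" "\<lambda>_. l"
  by (rule Ionescu_Tulcea_markov_step[OF kernel l])

lemma sets_initial_law: "sets l = sets E"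
  using l by (simp add: space_prob_algebra)

lemmas measurable_cong_initial_law [measurable_cong] = sets_initial_law

lemma sets_markov_measure: "sets (markov_measure p l) = sets paths"
  unfolding markov_measure_def by (simp add: sets_initial_law cong: sets_PiM_cong)

lemma prob_space_markov_measure: "prob_space (markov_measure p l)"
  unfolding markov_measure_def proof (rule prob_spaceI)
  interpret C: prob_space "IT.CI {}"
    by (rule IT.PF.prob_space_P) auto
  have "emeasure IT.PF.lim (space IT.PF.lim) = emeasure IT.PF.lim (IT.PF.emb UNIV {} (space (PiM {} (\<lambda>_. l))))"
    by (rule arg_cong[where f="emeasure _"]) (auto simp: prod_emb_def space_PiM)
  also have "\<dots> = emeasure (IT.CI {}) (space (IT.CI {}))"
    by (subst IT.lim) (simp_all add: IT.PF.space_P)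
  finally show "emeasure IT.PF.lim (space IT.PF.lim) = 1"
    by (simp only: C.emeasure_space_1)
qed

text \<open>
  The induction adds a step at the end of the path, as in the construction of the finite-dimensional
  laws, and moves it into the test function; \<open>path_weight_snoc\<close> then turns the result into a
  recursion from the front.
\<close>
lemma nn_integral_finite_path_law:
  assumes A: "\<And>i. A i \<in> sets E" and "g \<in> borel_measurable E"
  shows "(\<integral>\<^sup>+\<omega>. (\<Prod>i\<le>n. indicator (A i) (\<omega> i)) * g (\<omega> n) \<partial>IT.C 0 (Suc n) (\<lambda>_. undefined)) =
         (\<integral>\<^sup>+\<beta>. path_weight p n A g \<beta> \<partial>l)"
  using assms(2)
proof (induction n arbitrary: g)
  case 0
  let ?u = "\<lambda>_::nat. undefined"
  note [measurable] = A 0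
  have "(\<lambda>\<omega>. (\<Prod>i\<le>0::nat. indicator (A i) (\<omega> i)) * g (\<omega> 0) :: ennreal)
      \<in> borel_measurable (PiM {0..<Suc 0} (\<lambda>_. l))" by measurable
  moreover have "?u \<in> space (PiM {0..<0} (\<lambda>_. l))" by (simp add: space_PiM)
  moreover have "IT.C 0 (Suc 0) ?u = IT.eP 0 ?u"
    using bind_return[OF IT.measurable_eP, of ?u 0] by (simp add: space_PiM)
  ultimately show ?case
    by (simp add: IT.nn_integral_eP del: IT.C.simps) (simp add: markov_step_def)
next
  case (Suc n)
  note [measurable] = A Suc.prems
  let ?u = "\<lambda>_. undefined"
  let ?g' = "\<lambda>\<beta>. \<integral>\<^sup>+\<gamma>. indicator (A (Suc n)) \<gamma> * g \<gamma> \<partial>p \<beta>"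
  have "(\<integral>\<^sup>+\<omega>. (\<Prod>i\<le>Suc n. indicator (A i) (\<omega> i)) * g (\<omega> (Suc n)) \<partial>IT.C 0 (Suc (Suc n)) ?u) =
        (\<integral>\<^sup>+\<omega>. \<integral>\<^sup>+\<omega>'. (\<Prod>i\<le>Suc n. indicator (A i) (\<omega>' i)) * g (\<omega>' (Suc n)) \<partial>IT.eP (Suc n) \<omega>
           \<partial>IT.C 0 (Suc n) ?u)"
    unfolding IT.C.simps(2)[of 0 "Suc n"]
    by (subst nn_integral_bind[where B="PiM {0..<Suc (0 + Suc n)} (\<lambda>_. l)"])
       (simp_all add: measurable_cong_sets[OF IT.sets_C refl] space_PiM del: IT.C.simps)
  also have "\<dots> = (\<integral>\<^sup>+\<omega>. (\<Prod>i\<le>n. indicator (A i) (\<omega> i)) * ?g' (\<omega> n) \<partial>IT.C 0 (Suc n) ?u)"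
  proof (rule nn_integral_cong)
    fix \<omega> assume "\<omega> \<in> space (IT.C 0 (Suc n) ?u)"
    then have \<omega>: "\<omega> \<in> space (PiM {0..<Suc n} (\<lambda>_. l))"
      by (simp add: IT.space_C space_PiM del: IT.C.simps)
    then have "\<omega> n \<in> space E"
      by (auto simp: space_PiM sets_eq_imp_space_eq[OF sets_initial_law])
    note sets_p = sets_kernel[OF kernel_subprob this]
    have "(\<Prod>i\<le>Suc n. indicator (A i) ((fun_upd \<omega> (Suc n) x) i)) * g ((fun_upd \<omega> (Suc n) x) (Suc n)) =
          (\<Prod>i\<le>n. indicator (A i) (\<omega> i)) * (indicator (A (Suc n)) x * g x)" for x
      by (simp add: mult_ac)
    moreover have "(\<lambda>x. indicator (A (Suc n)) x * g x) \<in> borel_measurable (p (\<omega> n))"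
      unfolding measurable_cong_sets[OF sets_p refl] by measurable
    ultimately show "(\<integral>\<^sup>+\<omega>'. (\<Prod>i\<le>Suc n. indicator (A i) (\<omega>' i)) * g (\<omega>' (Suc n)) \<partial>IT.eP (Suc n) \<omega>) =
          (\<Prod>i\<le>n. indicator (A i) (\<omega> i)) * ?g' (\<omega> n)"
      by (subst IT.nn_integral_eP[OF \<omega>])
         (simp_all add: markov_step_def nn_integral_cmult del: prod.atMost_Suc fun_upd_apply)
  qed
  also have "\<dots> = (\<integral>\<^sup>+\<beta>. path_weight p (Suc n) A g \<beta> \<partial>l)"
    unfolding path_weight_snoc by (rule Suc.IH) measurable
  finally show ?case .
qed

lemma emeasure_markov_measure_cylinder:
  assumes A: "\<And>i. A i \<in> sets E"
  shows "emeasure (markov_measure p l) (cylinder E (Suc n) A) = (\<integral>\<^sup>+\<beta>. path_weight p n A (\<lambda>_. 1) \<beta> \<partial>l)"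
proof -
  let ?J = "{0..<Suc n}"
  let ?X = "Pi\<^sub>E ?J A" and ?u = "\<lambda>_. undefined"
  have X [measurable]: "?X \<in> sets (PiM ?J (\<lambda>_. l))"
    using A by (intro sets_PiM_I_finite) (auto simp: sets_initial_law)
  have "emeasure (markov_measure p l) (cylinder E (Suc n) A) = emeasure (IT.CI ?J) ?X"
    unfolding markov_measure_def using IT.lim[OF _ X]
    by (simp add: prod_emb_def sets_eq_imp_space_eq[OF sets_initial_law] lessThan_atLeast0)
  also have "\<dots> = emeasure (IT.C 0 (Suc n) ?u) ?X"
    by (subst IT.emeasure_CI[OF _ X, of "Suc n"]) (use sets.sets_into_space[OF X] in \<open>simp_all add: prod_emb_id space_PiM\<close>)
  also have "\<dots> = (\<integral>\<^sup>+\<omega>. indicator ?X \<omega> \<partial>IT.C 0 (Suc n) ?u)"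
    using X by (subst nn_integral_indicator) (simp_all add: IT.sets_C space_PiM del: IT.C.simps)
  also have "\<dots> = (\<integral>\<^sup>+\<omega>. (\<Prod>i\<le>n. indicator (A i) (\<omega> i)) * 1 \<partial>IT.C 0 (Suc n) ?u)"
    by (rule nn_integral_cong)
       (auto simp: IT.space_C space_PiM PiE_iff less_Suc_eq_le prod_zero_iff split: split_indicator
             simp del: IT.C.simps)
  also have "\<dots> = (\<integral>\<^sup>+\<beta>. path_weight p n A (\<lambda>_. 1) \<beta> \<partial>l)"
    by (rule nn_integral_finite_path_law[OF A]) simp
  finally show ?thesis .
qed

end

text \<open>
  The law of the letters read after time 0 by the chain that is in \<open>\<alpha>\<close> at time 0. The letter \<open>\<alpha>\<close>
  itself is not part of the path, to match the role of \<open>\<omega>\<close> in the skew product.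
\<close>
definition path_kernel :: "'e \<Rightarrow> (nat \<Rightarrow> 'e) measure" where
  "path_kernel \<alpha> = markov_measure p (p \<alpha>)"

lemma kernel_in_space: "\<alpha> \<in> space E \<Longrightarrow> p \<alpha> \<in> space (prob_algebra E)"
  using measurable_space[OF kernel] .

lemma emeasure_path_kernel_cylinder:
  assumes "\<alpha> \<in> space E" and "\<And>i. A i \<in> sets E"
  shows "emeasure (path_kernel \<alpha>) (cylinder E (Suc n) A) = (\<integral>\<^sup>+\<beta>. path_weight p n A (\<lambda>_. 1) \<beta> \<partial>p \<alpha>)"
  unfolding path_kernel_def by (rule emeasure_markov_measure_cylinder[OF kernel_in_space]) fact+

text \<open>Measurability in \<open>\<alpha>\<close> need only be checked on cylinders, where the mass is explicit.\<close>
lemma path_kernel: "path_kernel \<in> E \<rightarrow>\<^sub>M prob_algebra paths"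
proof (rule measurable_prob_algebra_generated[OF sets_PiM Int_stable_prod_algebra prod_algebra_sets_into_space])
  fix \<alpha> assume "\<alpha> \<in> space E"
  then show "prob_space (path_kernel \<alpha>)" "sets (path_kernel \<alpha>) = sets paths"
    unfolding path_kernel_def
    by (intro prob_space_markov_measure sets_markov_measure kernel_in_space; assumption)+
next
  fix X assume "X \<in> prod_algebra UNIV (\<lambda>_::nat. E)"
  then obtain J A where X: "X = prod_emb UNIV (\<lambda>_. E) J (\<Pi>\<^sub>E j\<in>J. A j)"
    and "finite J" and A: "\<And>j. j \<in> J \<Longrightarrow> A j \<in> sets E"
    by (force elim!: prod_algebraE)
  then obtain n where "X = cylinder E (Suc n) (\<lambda>i. if i \<in> J then A i else space E)"
    using prod_emb_eq_cylinder by metis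
  moreover have [measurable]: "(if i \<in> J then A i else space E) \<in> sets E" for i
    using A by simp
  ultimately have "emeasure (path_kernel \<alpha>) X =
      (\<integral>\<^sup>+\<beta>. path_weight p n (\<lambda>i. if i \<in> J then A i else space E) (\<lambda>_. 1) \<beta> \<partial>p \<alpha>)"
    if "\<alpha> \<in> space E" for \<alpha>
    using that by (simp add: emeasure_path_kernel_cylinder)
  then show "(\<lambda>\<alpha>. emeasure (path_kernel \<alpha>) X) \<in> borel_measurable E"
    by (subst measurable_cong[where g="\<lambda>\<alpha>. \<integral>\<^sup>+\<beta>. path_weight p n (\<lambda>i. if i \<in> J then A i else space E) (\<lambda>_. 1) \<beta> \<partial>p \<alpha>"]) (simp, measurable)
qed

lemmas path_kernel_subprob [measurable] = measurable_prob_algebraD[OF path_kernel]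

lemma path_kernel_in_space: "\<alpha> \<in> space E \<Longrightarrow> path_kernel \<alpha> \<in> space (prob_algebra paths)"
  using measurable_space[OF path_kernel] .

lemma measurable_case_nat_paths [measurable]:
  "(\<lambda>(\<beta>, \<omega>). case_nat \<beta> \<omega>) \<in> E \<Otimes>\<^sub>M paths \<rightarrow>\<^sub>M paths"
proof -
  have "(\<lambda>x. case_nat (fst x) (snd x)) \<in> E \<Otimes>\<^sub>M paths \<rightarrow>\<^sub>M paths"
  proof (rule measurable_PiM_single')
    show "(\<lambda>x. case_nat (fst x) (snd x) i) \<in> E \<Otimes>\<^sub>M paths \<rightarrow>\<^sub>M E" for i
      by (cases i) auto
  qed (auto simp: space_pair_measure space_PiM PiE_iff split: nat.split)
  then show ?thesis by (simp add: case_prod_beta')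
qed

lemma measurable_cons_letter [measurable]: "\<beta> \<in> space E \<Longrightarrow> case_nat \<beta> \<in> paths \<rightarrow>\<^sub>M paths"
  using measurable_Pair2[OF measurable_case_nat_paths] by simp

lemma measurable_shift_paths [measurable]: "(\<lambda>\<omega> n. \<omega> (Suc n)) \<in> paths \<rightarrow>\<^sub>M paths"
  by (rule measurable_PiM_single') (auto simp: space_PiM PiE_iff)

lemma first_step_kernel: "(\<lambda>\<beta>. distr (path_kernel \<beta>) paths (case_nat \<beta>)) \<in> E \<rightarrow>\<^sub>M prob_algebra paths"
  by (rule measurable_distr_prob_space2[OF path_kernel]) measurable

text \<open>
  The Markov property at time 0: the tail of the path depends on the initial law only through the
  first letter. Both sides give the same mass to a cylinder, by the recursion that defines
  \<open>path_weight\<close>.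
\<close>
lemma markov_measure_first_step:
  assumes l: "l \<in> space (prob_algebra E)"
  shows "markov_measure p l = l \<bind> (\<lambda>\<beta>. distr (path_kernel \<beta>) paths (case_nat \<beta>))"
proof (rule measure_eqI_cylinder)
  show "sets (l \<bind> (\<lambda>\<beta>. distr (path_kernel \<beta>) paths (case_nat \<beta>))) = sets paths"
    by (rule sets_bind'[OF l first_step_kernel])
  show "sets (markov_measure p l) = sets paths"
    by (rule sets_markov_measure[OF l])
  show "finite_measure (markov_measure p l)"
    using prob_space_markov_measure[OF l] by (simp add: prob_space_def)
  fix n and A :: "nat \<Rightarrow> 'e set" assume A: "\<And>i. A i \<in> sets E"
  have "emeasure (distr (path_kernel \<beta>) paths (case_nat \<beta>)) (cylinder E (Suc n) A) =
        path_weight p n A (\<lambda>_. 1) \<beta>" if \<beta>: "\<beta> \<in> space E" for \<beta>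
  proof -
    have "space (path_kernel \<beta>) = space paths" "sets (path_kernel \<beta>) = sets paths" "prob_space (path_kernel \<beta>)"
      using path_kernel_in_space[OF \<beta>] by (auto simp: space_prob_algebra dest: sets_eq_imp_space_eq)
    note P = this
    have "emeasure (distr (path_kernel \<beta>) paths (case_nat \<beta>)) (cylinder E (Suc n) A) =
        emeasure (path_kernel \<beta>) (case_nat \<beta> -` cylinder E (Suc n) A \<inter> space paths)"
      using A \<beta> by (subst emeasure_distr) (auto simp: P measurable_cong_sets[OF P(2) refl])
    also have "case_nat \<beta> -` cylinder E (Suc n) A \<inter> space paths =
        (if \<beta> \<in> A 0 then cylinder E n (\<lambda>i. A (Suc i)) else {})"
      using measurable_space[OF measurable_cons_letter[OF \<beta>]]
      by (auto simp: cylinder_iff All_less_Suc2)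
    also have "emeasure (path_kernel \<beta>) \<dots> = path_weight p n A (\<lambda>_. 1) \<beta>"
    proof (cases n)
      case 0
      have "cylinder E 0 (\<lambda>i. A (Suc i)) = space (path_kernel \<beta>)"
        by (rule set_eqI) (simp only: cylinder_iff P, simp)
      with 0 show ?thesis
        by (simp add: prob_space.emeasure_space_1[OF P(3)])
    next
      case (Suc k)
      then show ?thesis
        using emeasure_path_kernel_cylinder[OF \<beta>, of "\<lambda>i. A (Suc i)" k] A by simp
    qed
    finally show ?thesis .
  qed
  then show "emeasure (markov_measure p l) (cylinder E (Suc n) A) =
     emeasure (l \<bind> (\<lambda>\<beta>. distr (path_kernel \<beta>) paths (case_nat \<beta>))) (cylinder E (Suc n) A)"
    using A by (auto simp: emeasure_bind_prob_algebra[OF l first_step_kernel] emeasure_markov_measure_cylinder[OF l]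
      sets_eq_imp_space_eq[OF sets_initial_law[OF l]] intro!: nn_integral_cong)
qed

lemma nn_integral_markov_measure:
  assumes l: "l \<in> space (prob_algebra E)" and g [measurable]: "g \<in> borel_measurable paths"
  shows "(\<integral>\<^sup>+\<omega>. g \<omega> \<partial>markov_measure p l) = (\<integral>\<^sup>+\<beta>. \<integral>\<^sup>+\<omega>. g (case_nat \<beta> \<omega>) \<partial>path_kernel \<beta> \<partial>l)"
proof -
  have "(\<lambda>\<beta>. distr (path_kernel \<beta>) paths (case_nat \<beta>)) \<in> l \<rightarrow>\<^sub>M subprob_algebra paths"
    using measurable_prob_algebraD[OF first_step_kernel] by (simp add: measurable_cong_sets[OF sets_initial_law[OF l] refl])
  then have "(\<integral>\<^sup>+\<omega>. g \<omega> \<partial>markov_measure p l) =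
      (\<integral>\<^sup>+\<beta>. \<integral>\<^sup>+\<omega>. g \<omega> \<partial>distr (path_kernel \<beta>) paths (case_nat \<beta>) \<partial>l)"
    unfolding markov_measure_first_step[OF l] by (rule nn_integral_bind[OF g])
  also have "\<dots> = (\<integral>\<^sup>+\<beta>. \<integral>\<^sup>+\<omega>. g (case_nat \<beta> \<omega>) \<partial>path_kernel \<beta> \<partial>l)"
    by (intro nn_integral_cong nn_integral_distr)
       (simp_all add: sets_eq_imp_space_eq[OF sets_initial_law[OF l]] subprob_measurableD[OF path_kernel_subprob])
  finally show ?thesis .
qed

lemma nn_integral_path_kernel:
  assumes "\<alpha> \<in> space E" and "g \<in> borel_measurable paths"
  shows "(\<integral>\<^sup>+\<omega>. g \<omega> \<partial>path_kernel \<alpha>) = (\<integral>\<^sup>+\<beta>. \<integral>\<^sup>+\<omega>. g (case_nat \<beta> \<omega>) \<partial>path_kernel \<beta> \<partial>p \<alpha>)"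
  using nn_integral_markov_measure[OF kernel_in_space[OF assms(1)] assms(2)] by (simp add: path_kernel_def)

end

section \<open>Ergodic stationary measures of a kernel\<close>

lemma stationary_bind:
  assumes \<kappa>: "\<kappa> \<in> X \<rightarrow>\<^sub>M prob_algebra X" and "stationary X \<kappa> \<nu>"
  shows "\<nu> \<bind> \<kappa> = \<nu>"
proof (rule measure_eqI)
  have \<nu>: "\<nu> \<in> space (prob_algebra X)" and sets: "sets \<nu> = sets X"
    using assms by (auto simp: stationary_def space_prob_algebra)
  show "sets (\<nu> \<bind> \<kappa>) = sets \<nu>"
    by (simp add: sets sets_bind'[OF \<nu> \<kappa>])
  fix A assume "A \<in> sets (\<nu> \<bind> \<kappa>)"
  then show "emeasure (\<nu> \<bind> \<kappa>) A = emeasure \<nu> A"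
    using assms by (simp add: sets_bind'[OF \<nu> \<kappa>] emeasure_bind_prob_algebra[OF \<nu> \<kappa>] stationary_def)
qed

context
  fixes X :: "'x measure" and \<kappa> :: "'x \<Rightarrow> 'x measure" and \<nu> :: "'x measure"
  assumes \<kappa>: "\<kappa> \<in> X \<rightarrow>\<^sub>M prob_algebra X" and \<nu>: "stationary X \<kappa> \<nu>"
begin

lemma stationary_facts:
  shows "\<kappa> \<in> \<nu> \<rightarrow>\<^sub>M subprob_algebra X" and "prob_space \<nu>" and "sets \<nu> = sets X" and "space \<nu> = space X"
proof -
  show 1: "prob_space \<nu>" "sets \<nu> = sets X"
    using \<nu> by (auto simp: stationary_def space_prob_algebra)
  then show "space \<nu> = space X" "\<kappa> \<in> \<nu> \<rightarrow>\<^sub>M subprob_algebra X"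
    using measurable_prob_algebraD[OF \<kappa>] by (auto dest: sets_eq_imp_space_eq simp: measurable_cong_sets[OF 1(2) refl])
qed

lemma nn_integral_stationary:
  assumes "g \<in> borel_measurable X"
  shows "(\<integral>\<^sup>+z. \<integral>\<^sup>+w. g w \<partial>\<kappa> z \<partial>\<nu>) = (\<integral>\<^sup>+z. g z \<partial>\<nu>)"
  using nn_integral_bind[OF assms stationary_facts(1)] stationary_bind[OF \<kappa> \<nu>] by simp

lemma AE_stationary:
  assumes "Measurable.pred X P" and "AE w in \<nu>. P w"
  shows "AE z in \<nu>. AE w in \<kappa> z. P w"
  using assms(2) unfolding AE_bind[OF stationary_facts(1) assms(1), symmetric] stationary_bind[OF \<kappa> \<nu>] .

text \<open>
  Harmonicity makes \<open>V x = (\<integral>y. (h y)\<^sup>2 \<partial>\<kappa> x) - (h x)\<^sup>2\<close> the variance of \<open>h\<close> under \<open>\<kappa> x\<close>, so it is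
  nonnegative. The two terms have the same \<open>\<nu>\<close>-integral by stationarity, so \<open>V\<close> vanishes almost
  everywhere.
\<close>
lemma AE_harmonic_function_constant_along_chain:
  fixes h :: "'x \<Rightarrow> real"
  assumes h [measurable]: "h \<in> borel_measurable X" and bounds: "\<And>x. x \<in> space X \<Longrightarrow> \<bar>h x\<bar> \<le> 1"
    and harmonic: "\<And>x. x \<in> space X \<Longrightarrow> (\<integral>y. h y \<partial>\<kappa> x) = h x"
  shows "AE x in \<nu>. AE y in \<kappa> x. h y = h x"
proof -
  note [measurable] = measurable_prob_algebraD[OF \<kappa>] stationary_facts(1)
  note [measurable_cong] = stationary_facts(3)
  note space = stationary_facts(4)
  interpret \<nu>: prob_space \<nu> by (rule stationary_facts)
  have sq_bounds: "\<bar>(h x)\<^sup>2\<bar> \<le> 1" if "x \<in> space X" for x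
    using bounds[OF that] by (simp add: abs_square_le_1)
  have \<kappa>x: "prob_space (\<kappa> x)" "sets (\<kappa> x) = sets X" "space (\<kappa> x) = space X" if "x \<in> space X" for x
    using measurable_space[OF \<kappa> that] by (auto simp: space_prob_algebra dest: sets_eq_imp_space_eq)
  have int: "integrable (\<kappa> x) h" "integrable (\<kappa> x) (\<lambda>y. (h y)\<^sup>2)" if x: "x \<in> space X" for x
  proof -
    interpret prob_space "\<kappa> x" by (rule \<kappa>x[OF x])
    show "integrable (\<kappa> x) h" "integrable (\<kappa> x) (\<lambda>y. (h y)\<^sup>2)"
      using x bounds sq_bounds
      by (auto intro!: integrable_const_bound[where B=1] simp: \<kappa>x measurable_cong_sets[OF \<kappa>x(2)[OF x] refl])
  qed
  define V where "V x = (\<integral>y. (h y)\<^sup>2 \<partial>\<kappa> x) - (h x)\<^sup>2" for x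
  have V: "V x = (\<integral>y. (h y - h x)\<^sup>2 \<partial>\<kappa> x)" if x: "x \<in> space X" for x
  proof -
    interpret prob_space "\<kappa> x" by (rule \<kappa>x[OF x])
    have "(\<integral>y. (h y - h x)\<^sup>2 \<partial>\<kappa> x) = (\<integral>y. (h y)\<^sup>2 - 2 * h x * h y + (h x)\<^sup>2 \<partial>\<kappa> x)"
      by (simp add: power2_diff algebra_simps)
    also have "\<dots> = (\<integral>y. (h y)\<^sup>2 \<partial>\<kappa> x) - 2 * h x * (\<integral>y. h y \<partial>\<kappa> x) + (h x)\<^sup>2"
      using int[OF x] by (simp add: prob_space)
    also have "\<dots> = V x"
      by (simp add: V_def harmonic[OF x] power2_eq_square)
    finally show ?thesis by simp
  qed
  have 1: "integrable \<nu> (\<lambda>x. \<integral>y. (h y)\<^sup>2 \<partial>\<kappa> x)"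
  proof (rule \<nu>.integrable_const_bound[where B=1])
    show "AE x in \<nu>. norm (\<integral>y. (h y)\<^sup>2 \<partial>\<kappa> x) \<le> 1"
    proof (rule AE_I2)
      fix x assume "x \<in> space \<nu>"
      then have x: "x \<in> space X" by (simp add: space)
      interpret prob_space "\<kappa> x" by (rule \<kappa>x[OF x])
      have "(\<integral>y. (h y)\<^sup>2 \<partial>\<kappa> x) \<le> 1"
        using int[OF x] sq_bounds by (intro integral_le_const AE_I2) (auto simp: \<kappa>x[OF x])
      then show "norm (\<integral>y. (h y)\<^sup>2 \<partial>\<kappa> x) \<le> 1" by simp
    qed
  qed measurable
  have 2: "integrable \<nu> (\<lambda>x. (h x)\<^sup>2)"
    using sq_bounds by (intro \<nu>.integrable_const_bound[where B=1] AE_I2) (auto simp: space)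
  have "(\<integral>x. (h x)\<^sup>2 \<partial>\<nu>) = (\<integral>x. (h x)\<^sup>2 \<partial>(\<nu> \<bind> \<kappa>))"
    by (simp add: stationary_bind[OF \<kappa> \<nu>])
  also have "\<dots> = (\<integral>x. \<integral>y. (h y)\<^sup>2 \<partial>\<kappa> x \<partial>\<nu>)"
    using sq_bounds
    by (intro integral_bind[where K=X and B=1 and B'=1] \<nu>.finite_measure_axioms AE_I2)
       (auto simp: space prob_space.emeasure_space_1[OF \<kappa>x(1)])
  finally have "(\<integral>x. V x \<partial>\<nu>) = 0"
    using 1 2 by (simp add: V_def)
  moreover have "integrable \<nu> V"
    using 1 2 by (simp add: V_def[abs_def])
  moreover have "AE x in \<nu>. 0 \<le> V x"
    by (auto simp: V space)
  ultimately have "AE x in \<nu>. V x = 0"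
    using integral_nonneg_eq_0_iff_AE by blast
  have step: "AE y in \<kappa> x. h y = h x" if x: "x \<in> space X" and V0: "V x = 0" for x
  proof -
    interpret prob_space "\<kappa> x" by (rule \<kappa>x[OF x])
    have "integrable (\<kappa> x) (\<lambda>y. (h y - h x)\<^sup>2)"
      using int[OF x] by (simp add: power2_diff)
    then have "AE y in \<kappa> x. (h y - h x)\<^sup>2 = 0"
      using V0 V[OF x] by (simp add: integral_nonneg_eq_0_iff_AE)
    then show ?thesis by simp
  qed
  from \<open>AE x in \<nu>. V x = 0\<close> AE_space show ?thesis
    by eventually_elim (simp add: space step)
qed

text \<open>
  As \<open>h\<close> does not change along the chain, the set where it exceeds its mean \<open>c\<close> is invariant. This
  set cannot have full measure, since \<open>h\<close> would then have a mean larger than \<open>c\<close>; so it is null, and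
  a function that is at most its mean equals it almost everywhere.
\<close>
lemma AE_harmonic_function_constant:
  fixes h :: "'x \<Rightarrow> real"
  assumes ergodic: "ergodic_stationary X \<kappa> \<nu>"
    and h [measurable]: "h \<in> borel_measurable X" and bounds: "\<And>x. x \<in> space X \<Longrightarrow> \<bar>h x\<bar> \<le> 1"
    and harmonic: "\<And>x. x \<in> space X \<Longrightarrow> (\<integral>y. h y \<partial>\<kappa> x) = h x"
  shows "AE x in \<nu>. h x = (\<integral>y. h y \<partial>\<nu>)"
proof -
  note [measurable_cong] = stationary_facts(3)
  note space = stationary_facts(4)
  interpret \<nu>: prob_space \<nu> by (rule stationary_facts)
  define c where "c = (\<integral>y. h y \<partial>\<nu>)"
  define B where "B = {x \<in> space X. c < h x}"
  have B [measurable]: "B \<in> sets X"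
    unfolding B_def by measurable
  have along_chain: "AE x in \<nu>. AE y in \<kappa> x. h y = h x"
    using h bounds harmonic by (rule AE_harmonic_function_constant_along_chain)
  have step: "emeasure (\<kappa> x) B = indicator B x" if x: "x \<in> space X" and const: "AE y in \<kappa> x. h y = h x" for x
  proof -
    have sets: "sets (\<kappa> x) = sets X" "space (\<kappa> x) = space X" and prob: "prob_space (\<kappa> x)"
      using measurable_space[OF \<kappa> x] by (auto simp: space_prob_algebra dest: sets_eq_imp_space_eq)
    interpret prob_space "\<kappa> x" by fact
    have AE: "AE y in \<kappa> x. y \<in> B \<longleftrightarrow> x \<in> B"
      using const AE_space by eventually_elim (use x in \<open>simp add: B_def sets\<close>)
    show ?thesis
    proof (cases "x \<in> B")
      case True
      with AE show ?thesis
        by (simp add: emeasure_eq_1_AE sets B)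
    next
      case False
      with AE have "B \<in> null_sets (\<kappa> x)"
        using AE_iff_null_sets[of B "\<kappa> x"] by (simp add: sets B)
      with False show ?thesis by (simp add: null_setsD1)
    qed
  qed
  from along_chain AE_space have "AE x in \<nu>. emeasure (\<kappa> x) B = indicator B x"
    by eventually_elim (simp add: space step)
  then have "emeasure \<nu> B \<in> {0, 1}"
    using ergodic B by (auto simp: ergodic_stationary_def)
  have int: "integrable \<nu> h"
    using bounds by (intro \<nu>.integrable_const_bound[where B=1]) (auto simp: space)
  have "emeasure \<nu> B \<noteq> 1"
  proof
    assume "emeasure \<nu> B = 1"
    then have "AE x in \<nu>. x \<in> B"
      by (simp add: \<nu>.emeasure_eq_measure \<nu>.AE_in_set_eq_1)
    then have "AE x in \<nu>. c < h x"
      by eventually_elim (simp add: B_def)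
    from \<nu>.expectation_greater[OF int this] show False by (simp add: c_def)
  qed
  with \<open>emeasure \<nu> B \<in> {0, 1}\<close> have "emeasure \<nu> B = 0" by blast
  then have "B \<in> null_sets \<nu>" using B by (simp add: null_sets_def stationary_facts(3))
  then have "AE x in \<nu>. x \<notin> B" by (rule AE_not_in)
  then have "AE x in \<nu>. 0 \<le> c - h x"
    using AE_space by eventually_elim (simp add: B_def space not_less)
  moreover have "(\<integral>x. c - h x \<partial>\<nu>) = 0"
    using int by (simp add: c_def \<nu>.prob_space)
  moreover have "integrable \<nu> (\<lambda>x. c - h x)"
    using int by simp
  ultimately have "AE x in \<nu>. c - h x = 0"
    using integral_nonneg_eq_0_iff_AE by blast
  then show ?thesis
    by eventually_elim (simp add: c_def)
qed

end

section \<open>Trajectories of a chain and the shift\<close>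

text \<open>
  An abstract description of the trajectories of a chain with kernel \<open>\<kappa>\<close> on \<open>Z\<close>. A point of \<open>Y\<close>
  encodes a trajectory from time 1 on, \<open>\<pi>\<close> reads the state at time 1, \<open>T\<close> deletes that state, and
  \<open>K z\<close> is the law of the trajectory when the state at time 0 is \<open>z\<close>. The last assumption is the
  Markov property at time 1. Only \<open>\<pi>\<close> and \<open>T\<close> are prescribed, so that the encoding by a path and a
  point of the fibre is covered.
\<close>
locale trajectory_kernel =
  fixes Z :: "'z measure" and Y :: "'y measure"
    and \<kappa> :: "'z \<Rightarrow> 'z measure" and K :: "'z \<Rightarrow> 'y measure"
    and T :: "'y \<Rightarrow> 'y" and \<pi> :: "'y \<Rightarrow> 'z"
  assumes chain: "\<kappa> \<in> Z \<rightarrow>\<^sub>M prob_algebra Z" and trajectory: "K \<in> Z \<rightarrow>\<^sub>M prob_algebra Y"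
    and measurable_T [measurable]: "T \<in> Y \<rightarrow>\<^sub>M Y" and measurable_\<pi> [measurable]: "\<pi> \<in> Y \<rightarrow>\<^sub>M Z"
    and first_step: "\<And>z g. z \<in> space Z \<Longrightarrow> g \<in> borel_measurable (Z \<Otimes>\<^sub>M Y) \<Longrightarrow>
      (\<integral>\<^sup>+y. g (\<pi> y, T y) \<partial>K z) = (\<integral>\<^sup>+w. \<integral>\<^sup>+y. g (w, y) \<partial>K w \<partial>\<kappa> z)"
begin

lemmas chain_subprob [measurable] = measurable_prob_algebraD[OF chain]
lemmas trajectory_subprob [measurable] = measurable_prob_algebraD[OF trajectory]

lemma chain_facts:
  assumes "z \<in> space Z"
  shows "prob_space (\<kappa> z)" and "sets (\<kappa> z) = sets Z" and "space (\<kappa> z) = space Z"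
  using measurable_space[OF chain assms] by (auto simp: space_prob_algebra dest: sets_eq_imp_space_eq)

lemma trajectory_facts:
  assumes "z \<in> space Z"
  shows "prob_space (K z)" and "sets (K z) = sets Y" and "space (K z) = space Y"
  using measurable_space[OF trajectory assms] by (auto simp: space_prob_algebra dest: sets_eq_imp_space_eq)

lemma measurable_chain_eq: "z \<in> space Z \<Longrightarrow> measurable (\<kappa> z) N = measurable Z N"
  and measurable_trajectory_eq: "z \<in> space Z \<Longrightarrow> measurable (K z) N = measurable Y N"
  by (simp_all add: subprob_measurableD[OF chain_subprob] subprob_measurableD[OF trajectory_subprob])

lemma measurable_T_funpow [measurable]: "(T ^^ n) \<in> Y \<rightarrow>\<^sub>M Y"
  by (induction n) auto

lemma first_step_AE:
  assumes z: "z \<in> space Z" and P [measurable]: "Measurable.pred (Z \<Otimes>\<^sub>M Y) (\<lambda>(w, y). P w y)"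
  shows "(AE y in K z. P (\<pi> y) (T y)) \<longleftrightarrow> (AE w in \<kappa> z. AE y in K w. P w y)"
proof -
  note [measurable_cong] = trajectory_facts(2)[OF z] chain_facts(2)[OF z]
  define bad where "bad = {x \<in> space (Z \<Otimes>\<^sub>M Y). \<not> P (fst x) (snd x)}"
  have [measurable]: "bad \<in> sets (Z \<Otimes>\<^sub>M Y)"
    using P by (simp add: bad_def case_prod_beta')
  have "(AE y in K z. P (\<pi> y) (T y)) \<longleftrightarrow> (AE y in K z. indicator bad (\<pi> y, T y) = (0::ennreal))"
    by (intro AE_cong)
       (auto simp: bad_def trajectory_facts[OF z] space_pair_measure measurable_space[OF measurable_T]
         measurable_space[OF measurable_\<pi>] split: split_indicator)
  also have "\<dots> \<longleftrightarrow> (\<integral>\<^sup>+y. indicator bad (\<pi> y, T y) \<partial>K z) = 0"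
    by (rule nn_integral_0_iff_AE[symmetric]) (simp only: measurable_trajectory_eq[OF z], measurable)
  also have "\<dots> \<longleftrightarrow> (\<integral>\<^sup>+w. \<integral>\<^sup>+y. indicator bad (w, y) \<partial>K w \<partial>\<kappa> z) = 0"
    by (simp add: first_step[OF z])
  also have "\<dots> \<longleftrightarrow> (AE w in \<kappa> z. (\<integral>\<^sup>+y. indicator bad (w, y) \<partial>K w) = 0)"
    by (rule nn_integral_0_iff_AE) (simp add: measurable_chain_eq[OF z]
      nn_integral_measurable_subprob_algebra2[OF _ trajectory_subprob])
  also have "\<dots> \<longleftrightarrow> (AE w in \<kappa> z. AE y in K w. P w y)"
  proof (intro AE_cong)
    fix w assume "w \<in> space (\<kappa> z)"
    then have w: "w \<in> space Z" by (simp add: chain_facts[OF z])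
    note [measurable_cong] = trajectory_facts(2)[OF w]
    have "(\<integral>\<^sup>+y. indicator bad (w, y) \<partial>K w) = 0 \<longleftrightarrow> (AE y in K w. indicator bad (w, y) = (0::ennreal))"
      using w by (subst nn_integral_0_iff_AE) auto
    also have "\<dots> \<longleftrightarrow> (AE y in K w. P w y)"
      using w by (intro AE_cong) (auto simp: bad_def trajectory_facts[OF w] space_pair_measure split: split_indicator)
    finally show "(\<integral>\<^sup>+y. indicator bad (w, y) \<partial>K w) = 0 \<longleftrightarrow> (AE y in K w. P w y)" .
  qed
  finally show ?thesis .
qed

lemma nn_integral_first_state:
  assumes "z \<in> space Z" and [measurable]: "g \<in> borel_measurable Z"
  shows "(\<integral>\<^sup>+y. g (\<pi> y) \<partial>K z) = (\<integral>\<^sup>+w. g w \<partial>\<kappa> z)"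
proof -
  have "(\<integral>\<^sup>+y. g (\<pi> y) \<partial>K z) = (\<integral>\<^sup>+w. \<integral>\<^sup>+y. g w \<partial>K w \<partial>\<kappa> z)"
    using first_step[OF assms(1), of "\<lambda>x. g (fst x)"] by simp
  also have "\<dots> = (\<integral>\<^sup>+w. g w \<partial>\<kappa> z)"
    by (intro nn_integral_cong)
       (simp add: chain_facts[OF assms(1)] prob_space.emeasure_space_1[OF trajectory_facts(1)])
  finally show ?thesis .
qed

lemma AE_first_state:
  assumes z: "z \<in> space Z" and [measurable]: "Measurable.pred Z P"
  shows "(AE y in K z. P (\<pi> y)) \<longleftrightarrow> (AE w in \<kappa> z. P w)"
proof -
  have "(AE y in K z. P (\<pi> y)) \<longleftrightarrow> (AE w in \<kappa> z. AE y in K w. P w)"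
    using first_step_AE[OF z, of "\<lambda>w y. P w"] by simp
  also have "\<dots> \<longleftrightarrow> (AE w in \<kappa> z. P w)"
    by (intro AE_cong) (auto simp: chain_facts[OF z] prob_space.AE_const trajectory_facts)
  finally show ?thesis .
qed

text \<open>An invariant event does not depend on the first step, so one may condition on that step freely.\<close>
lemma trajectory_of_invariant_set_harmonic:
  assumes z: "z \<in> space Z" and A [measurable]: "A \<in> sets Y" and invariant: "T -` A \<inter> space Y = A"
  shows "(\<integral>w. measure (K w) A \<partial>\<kappa> z) = measure (K z) A"
proof -
  note [measurable_cong] = trajectory_facts(2)[OF z] chain_facts(2)[OF z]
  interpret \<kappa>z: prob_space "\<kappa> z" by (rule chain_facts[OF z])
  interpret Kz: prob_space "K z" by (rule trajectory_facts[OF z])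
  have "emeasure (K z) A = (\<integral>\<^sup>+y. indicator A y \<partial>K z)"
    using A by (simp add: trajectory_facts[OF z])
  also have "\<dots> = (\<integral>\<^sup>+y. indicator A (T y) \<partial>K z)"
    using invariant by (intro nn_integral_cong) (auto simp: trajectory_facts[OF z] split: split_indicator)
  also have "\<dots> = (\<integral>\<^sup>+w. \<integral>\<^sup>+y. indicator A y \<partial>K w \<partial>\<kappa> z)"
    using first_step[OF z, of "\<lambda>x. indicator A (snd x)"] by simp
  also have "\<dots> = (\<integral>\<^sup>+w. ennreal (measure (K w) A) \<partial>\<kappa> z)"
  proof (intro nn_integral_cong)
    fix w assume "w \<in> space (\<kappa> z)"
    then have w: "w \<in> space Z" by (simp add: chain_facts[OF z])
    interpret prob_space "K w" by (rule trajectory_facts[OF w])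
    show "(\<integral>\<^sup>+y. indicator A y \<partial>K w) = ennreal (measure (K w) A)"
      using A by (simp add: trajectory_facts[OF w] emeasure_eq_measure)
  qed
  finally have "ennreal (measure (K z) A) = (\<integral>\<^sup>+w. ennreal (measure (K w) A) \<partial>\<kappa> z)"
    by (simp add: Kz.emeasure_eq_measure)
  moreover have "(\<integral>w. measure (K w) A \<partial>\<kappa> z) = enn2real (\<integral>\<^sup>+w. ennreal (measure (K w) A) \<partial>\<kappa> z)"
    by (rule integral_eq_nn_integral) (simp_all add: measurable_chain_eq[OF z], measurable)
  ultimately show ?thesis
    by (metis enn2real_ennreal measure_nonneg)
qed

context
  fixes \<nu> :: "'z measure"
  assumes \<nu>: "stationary Z \<kappa> \<nu>"
begin

lemmas \<nu>_facts = stationary_facts[OF chain \<nu>]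

lemma \<nu>_in_space: "\<nu> \<in> space (prob_algebra Z)"
  using \<nu> by (simp add: stationary_def)

lemma lift_in_space: "\<nu> \<bind> K \<in> space (prob_algebra Y)"
  using prob_space_bind'[OF \<nu>_in_space trajectory] sets_bind'[OF \<nu>_in_space trajectory]
  by (simp add: space_prob_algebra)

lemma lift_facts: "prob_space (\<nu> \<bind> K)" "sets (\<nu> \<bind> K) = sets Y" "space (\<nu> \<bind> K) = space Y"
  using lift_in_space by (auto simp: space_prob_algebra dest: sets_eq_imp_space_eq)

lemma trajectory_from_stationary: "K \<in> \<nu> \<rightarrow>\<^sub>M subprob_algebra Y"
  using trajectory_subprob by (simp add: measurable_cong_sets[OF \<nu>_facts(3) refl])

lemma nn_integral_lift:
  "g \<in> borel_measurable Y \<Longrightarrow> (\<integral>\<^sup>+y. g y \<partial>(\<nu> \<bind> K)) = (\<integral>\<^sup>+z. \<integral>\<^sup>+y. g y \<partial>K z \<partial>\<nu>)"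
  by (rule nn_integral_bind[OF _ trajectory_from_stationary])

text \<open>Deleting a step replaces the law \<open>\<nu>\<close> of the starting state by \<open>\<nu> \<bind> \<kappa>\<close>, which is \<open>\<nu>\<close> again.\<close>
lemma lift_invariant: "distr (\<nu> \<bind> K) Y T = \<nu> \<bind> K"
proof (rule measure_eqI)
  note [measurable_cong] = lift_facts(2)
  fix A assume "A \<in> sets (distr (\<nu> \<bind> K) Y T)"
  then have A [measurable]: "A \<in> sets Y" by simp
  have "emeasure (distr (\<nu> \<bind> K) Y T) A = (\<integral>\<^sup>+y. indicator A y \<partial>distr (\<nu> \<bind> K) Y T)"
    by simp
  also have "\<dots> = (\<integral>\<^sup>+z. \<integral>\<^sup>+y. indicator A (T y) \<partial>K z \<partial>\<nu>)"
    by (subst nn_integral_distr) (simp_all add: nn_integral_lift)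
  also have "\<dots> = (\<integral>\<^sup>+z. \<integral>\<^sup>+w. \<integral>\<^sup>+y. indicator A y \<partial>K w \<partial>\<kappa> z \<partial>\<nu>)"
    using first_step[of _ "\<lambda>x. indicator A (snd x)"] by (intro nn_integral_cong) (simp add: \<nu>_facts)
  also have "\<dots> = (\<integral>\<^sup>+z. \<integral>\<^sup>+y. indicator A y \<partial>K z \<partial>\<nu>)"
    by (rule nn_integral_stationary[OF chain \<nu>]) measurable
  also have "\<dots> = emeasure (\<nu> \<bind> K) A"
    using nn_integral_lift[of "indicator A"] A by (simp add: lift_facts)
  finally show "emeasure (distr (\<nu> \<bind> K) Y T) A = emeasure (\<nu> \<bind> K) A" .
qed (simp add: lift_facts)

lemma lift_first_state: "distr (\<nu> \<bind> K) Z \<pi> = \<nu>"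
proof (rule measure_eqI)
  note [measurable_cong] = lift_facts(2)
  fix A assume "A \<in> sets (distr (\<nu> \<bind> K) Z \<pi>)"
  then have A [measurable]: "A \<in> sets Z" by simp
  have "emeasure (distr (\<nu> \<bind> K) Z \<pi>) A = (\<integral>\<^sup>+y. indicator A y \<partial>distr (\<nu> \<bind> K) Z \<pi>)"
    by simp
  also have "\<dots> = (\<integral>\<^sup>+z. \<integral>\<^sup>+y. indicator A (\<pi> y) \<partial>K z \<partial>\<nu>)"
    by (subst nn_integral_distr) (simp_all add: nn_integral_lift)
  also have "\<dots> = (\<integral>\<^sup>+z. \<integral>\<^sup>+w. indicator A w \<partial>\<kappa> z \<partial>\<nu>)"
    by (intro nn_integral_cong nn_integral_first_state) (simp_all add: \<nu>_facts)
  also have "\<dots> = (\<integral>\<^sup>+z. indicator A z \<partial>\<nu>)"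
    by (rule nn_integral_stationary[OF chain \<nu>]) measurable
  finally show "emeasure (distr (\<nu> \<bind> K) Z \<pi>) A = emeasure \<nu> A"
    using A by (simp add: \<nu>_facts)
qed (simp add: \<nu>_facts)

lemma AE_lift_invariant:
  assumes "AE y in \<nu> \<bind> K. P y"
  shows "AE y in \<nu> \<bind> K. P ((T ^^ n) y)"
proof (induction n)
  case (Suc n)
  have "T \<in> (\<nu> \<bind> K) \<rightarrow>\<^sub>M Y"
    by (simp add: measurable_cong_sets[OF lift_facts(2) refl])
  moreover have "AE y in distr (\<nu> \<bind> K) Y T. P ((T ^^ n) y)"
    unfolding lift_invariant by (rule Suc)
  ultimately have "AE y in \<nu> \<bind> K. P ((T ^^ n) (T y))"
    by (rule AE_distrD)
  then show ?case by (simp add: funpow_swap1)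
qed (use assms in simp)

text \<open>
  The event \<open>\<pi> -` B\<close> is invariant only up to null sets, while ergodicity of \<open>T\<close> concerns strictly
  invariant sets. The event that \<open>B\<close> is visited infinitely often is strictly invariant and differs
  from \<open>\<pi> -` B\<close> by a null set.
\<close>
lemma stationary_ergodic_if_lift_ergodic:
  assumes ergodic: "ergodic_invariant Y T (\<nu> \<bind> K)"
  shows "ergodic_stationary Z \<kappa> \<nu>"
  unfolding ergodic_stationary_def
proof (intro conjI ballI impI \<nu>)
  fix B assume B [measurable]: "B \<in> sets Z" and AE_B: "AE z in \<nu>. emeasure (\<kappa> z) B = indicator B z"
  note [measurable_cong] = lift_facts(2) \<nu>_facts(3)
  define R where "R y \<longleftrightarrow> \<pi> y \<in> B" for y
  have [measurable]: "Measurable.pred Y R" unfolding R_def by measurable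
  have "AE z in \<nu>. AE w in \<kappa> z. emeasure (\<kappa> w) B = indicator B w"
    by (rule AE_stationary[OF chain \<nu> _ AE_B]) measurable
  then have stays: "AE z in \<nu>. AE w in \<kappa> z. AE y in K w. w \<in> B \<longleftrightarrow> R y"
    using AE_space
  proof eventually_elim
    fix z assume "z \<in> space \<nu>" and AE: "AE w in \<kappa> z. emeasure (\<kappa> w) B = indicator B w"
    then have z: "z \<in> space Z" by (simp add: \<nu>_facts)
    show "AE w in \<kappa> z. AE y in K w. w \<in> B \<longleftrightarrow> R y"
      using AE AE_space
    proof eventually_elim
      fix w assume "w \<in> space (\<kappa> z)" and wB: "emeasure (\<kappa> w) B = indicator B w"
      then have w: "w \<in> space Z" by (simp add: chain_facts[OF z])
      interpret prob_space "\<kappa> w" by (rule chain_facts[OF w])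
      have "AE v in \<kappa> w. w \<in> B \<longleftrightarrow> v \<in> B"
      proof (cases "w \<in> B")
        case True
        with wB have "AE v in \<kappa> w. v \<in> B"
          using B by (simp add: AE_in_set_eq_1 chain_facts[OF w] emeasure_eq_measure)
        with True show ?thesis by simp
      next
        case False
        with wB have "AE v in \<kappa> w. v \<notin> B"
          using AE_iff_null_sets[of B "\<kappa> w"] B by (simp add: chain_facts[OF w] null_sets_def)
        with False show ?thesis by simp
      qed
      then show "AE y in K w. w \<in> B \<longleftrightarrow> R y"
        unfolding R_def by (subst AE_first_state[OF w, of "\<lambda>v. w \<in> B \<longleftrightarrow> v \<in> B"]) simp_all
    qed
  qed
  \<comment> \<open>Membership in \<open>B\<close> does not change in one step; invariance of the lift then carries this to all times.\<close>
  from stays AE_space have "AE z in \<nu>. AE y in K z. \<pi> y \<in> B \<longleftrightarrow> R (T y)"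
    by eventually_elim (subst first_step_AE[where P="\<lambda>w y. w \<in> B \<longleftrightarrow> R y"], simp_all add: \<nu>_facts)
  then have "AE y in \<nu> \<bind> K. R y \<longleftrightarrow> R (T y)"
    by (subst AE_bind[OF trajectory_from_stationary]) (simp_all add: R_def)
  then have "AE y in \<nu> \<bind> K. R ((T ^^ n) y) \<longleftrightarrow> R (T ((T ^^ n) y))" for n
    by (rule AE_lift_invariant)
  then have "AE y in \<nu> \<bind> K. \<forall>n. R ((T ^^ n) y) \<longleftrightarrow> R ((T ^^ Suc n) y)"
    by (simp add: AE_all_countable)
  then have R_const: "AE y in \<nu> \<bind> K. \<forall>n. R ((T ^^ n) y) \<longleftrightarrow> R y"
  proof eventually_elim
    fix y assume "\<forall>n. R ((T ^^ n) y) \<longleftrightarrow> R ((T ^^ Suc n) y)"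
    then show "\<forall>n. R ((T ^^ n) y) \<longleftrightarrow> R y"
      by (intro allI, induct_tac n) auto
  qed
  \<comment> \<open>The limit superior of the events that the state at time \<open>n + 1\<close> is in \<open>B\<close>.\<close>
  define A where "A = {y \<in> space Y. \<forall>k. \<exists>n\<ge>k. R ((T ^^ n) y)}"
  have A [measurable]: "A \<in> sets Y"
    unfolding A_def by measurable
  have "T -` A \<inter> space Y = A"
  proof -
    have "(\<forall>k. \<exists>n\<ge>k. R ((T ^^ n) (T y))) \<longleftrightarrow> (\<forall>k. \<exists>n\<ge>k. R ((T ^^ n) y))" for y
    proof (intro iffI allI)
      fix k assume "\<forall>k. \<exists>n\<ge>k. R ((T ^^ n) (T y))"
      then obtain n where "n \<ge> k" "R ((T ^^ n) (T y))" by blast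
      then show "\<exists>n\<ge>k. R ((T ^^ n) y)"
        by (intro exI[of _ "Suc n"]) (simp add: funpow_swap1)
    next
      fix k assume "\<forall>k. \<exists>n\<ge>k. R ((T ^^ n) y)"
      then obtain n where "n \<ge> Suc k" "R ((T ^^ n) y)" by blast
      then show "\<exists>n\<ge>k. R ((T ^^ n) (T y))"
        by (cases n) (auto simp: funpow_swap1)
    qed
    then show ?thesis
      using measurable_space[OF measurable_T] by (auto simp: A_def)
  qed
  then have "emeasure (\<nu> \<bind> K) A \<in> {0, 1}"
    using ergodic A by (simp add: ergodic_invariant_def)
  moreover have "emeasure (\<nu> \<bind> K) A = emeasure (\<nu> \<bind> K) {y \<in> space Y. R y}"
  proof (rule emeasure_eq_AE)
    show "AE y in \<nu> \<bind> K. y \<in> A \<longleftrightarrow> y \<in> {y \<in> space Y. R y}"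
      using R_const AE_space by eventually_elim (auto simp: A_def)
  qed (simp_all add: lift_facts)
  moreover have "{y \<in> space Y. R y} = \<pi> -` B \<inter> space (\<nu> \<bind> K)"
    by (auto simp: R_def lift_facts)
  moreover have "emeasure (\<nu> \<bind> K) (\<pi> -` B \<inter> space (\<nu> \<bind> K)) = emeasure (distr (\<nu> \<bind> K) Z \<pi>) B"
    by (subst emeasure_distr) simp_all
  ultimately show "emeasure \<nu> B \<in> {0, 1}"
    by (simp add: lift_first_state)
qed

text \<open>Under an ergodic \<open>\<nu>\<close>, the starting state carries no information on an invariant event.\<close>
lemma AE_trajectory_of_invariant_set:
  assumes ergodic: "ergodic_stationary Z \<kappa> \<nu>"
    and A [measurable]: "A \<in> sets Y" and invariant: "T -` A \<inter> space Y = A"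
  shows "AE z in \<nu>. emeasure (K z) A = emeasure (\<nu> \<bind> K) A"
proof -
  interpret \<nu>: prob_space \<nu> by (rule \<nu>_facts)
  note [measurable_cong] = \<nu>_facts(3)
  have "AE z in \<nu>. measure (K z) A = (\<integral>z. measure (K z) A \<partial>\<nu>)"
  proof (rule AE_harmonic_function_constant[OF chain \<nu> ergodic])
    show "(\<lambda>z. measure (K z) A) \<in> borel_measurable Z"
      by measurable
    fix z assume z: "z \<in> space Z"
    then interpret prob_space "K z" by (rule trajectory_facts)
    show "\<bar>measure (K z) A\<bar> \<le> 1" by simp
    show "(\<integral>w. measure (K w) A \<partial>\<kappa> z) = measure (K z) A"
      by (rule trajectory_of_invariant_set_harmonic[OF z A invariant])
  qed
  then obtain c where c: "AE z in \<nu>. measure (K z) A = c" by blast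
  have c': "AE z in \<nu>. emeasure (K z) A = ennreal c"
    using c AE_space
    by eventually_elim
       (auto simp: \<nu>_facts finite_measure.emeasure_eq_measure prob_space.finite_measure trajectory_facts)
  have "emeasure (\<nu> \<bind> K) A = (\<integral>\<^sup>+z. emeasure (K z) A \<partial>\<nu>)"
    by (rule emeasure_bind_prob_algebra[OF \<nu>_in_space trajectory A])
  also have "\<dots> = (\<integral>\<^sup>+z. ennreal c \<partial>\<nu>)"
    by (rule nn_integral_cong_AE) (rule c')
  also have "\<dots> = ennreal c"
    by (simp add: \<nu>.emeasure_space_1)
  finally show ?thesis using c' by simp
qed

end

end

section \<open>The skew product as a shift\<close>

text \<open>
  The first component is handled for a fixed second side \<open>B\<close>: the slices over \<open>B\<close> are finite measures
  on the path space that agree on cylinders.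
\<close>
lemma measure_eqI_cylinder_rectangles:
  assumes P: "sets P = sets (PiM UNIV (\<lambda>_. E) \<Otimes>\<^sub>M M)" and Q: "sets Q = sets (PiM UNIV (\<lambda>_. E) \<Otimes>\<^sub>M M)"
    and "finite_measure P"
    and eq: "\<And>n A B. (\<And>i. A i \<in> sets E) \<Longrightarrow> B \<in> sets M \<Longrightarrow>
      emeasure P (cylinder E (Suc n) A \<times> B) = emeasure Q (cylinder E (Suc n) A \<times> B)"
  shows "P = Q"
proof (rule measure_eqI_rectangles[OF P Q \<open>finite_measure P\<close>])
  let ?S = "PiM UNIV (\<lambda>_::nat. E)"
  fix X B assume X: "X \<in> sets ?S" and B [measurable]: "B \<in> sets M"
  note [measurable_cong] = P Q
  define slice where "slice R = distr (density R (indicator (space ?S \<times> B))) ?S fst" for R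
  have slice: "emeasure (slice R) X = emeasure R (X \<times> B)"
    if R [measurable_cong]: "sets R = sets (?S \<Otimes>\<^sub>M M)" and [measurable]: "X \<in> sets ?S" for R X
  proof -
    have "emeasure (slice R) X = emeasure R ((space ?S \<times> B) \<inter> (fst -` X \<inter> space R))"
      unfolding slice_def
      by (subst emeasure_distr) (simp_all, subst emeasure_density, simp_all add: indicator_inter_arith[symmetric])
    also have "(space ?S \<times> B) \<inter> (fst -` X \<inter> space R) = X \<times> B"
      using sets.sets_into_space[of X ?S] sets.sets_into_space[OF B]
      by (auto simp: sets_eq_imp_space_eq[OF R] space_pair_measure)
    finally show ?thesis .
  qed
  have "slice P = slice Q"
  proof (rule measure_eqI_cylinder[where E=E])
    show "finite_measure (slice P)"
      using finite_measure.emeasure_finite[OF \<open>finite_measure P\<close>] slice[OF P sets.top]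
      by (intro finite_measureI) (simp add: slice_def)
    show "sets (slice P) = sets ?S" "sets (slice Q) = sets ?S"
      by (simp_all add: slice_def)
    show "emeasure (slice P) (cylinder E (Suc n) A) = emeasure (slice Q) (cylinder E (Suc n) A)"
      if "\<And>i. A i \<in> sets E" for n A
      using that by (simp add: slice P Q eq)
  qed
  then show "emeasure P (X \<times> B) = emeasure Q (X \<times> B)"
    using slice[OF P X] slice[OF Q X] by simp
qed

locale random_iteration = transition_kernel E p
  for E :: "'e measure" and p :: "'e \<Rightarrow> 'e measure" +
  fixes M :: "'m measure" and f :: "'e \<Rightarrow> 'm \<Rightarrow> 'm"
  assumes measurable_f: "case_prod f \<in> E \<Otimes>\<^sub>M M \<rightarrow>\<^sub>M M"
begin

abbreviation phase :: "((nat \<Rightarrow> 'e) \<times> 'm) measure" where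
  "phase \<equiv> paths \<Otimes>\<^sub>M M"

text \<open>
  The trajectory from \<open>(\<alpha>, x)\<close> is encoded by the letters after time 0 and the initial point \<open>x\<close>, from
  which all later points of the fibre are computed by iterating the maps \<open>f\<close>.
\<close>
definition trajectory :: "'e \<times> 'm \<Rightarrow> ((nat \<Rightarrow> 'e) \<times> 'm) measure" where
  "trajectory = (\<lambda>(\<alpha>, x). distr (path_kernel \<alpha>) phase (\<lambda>\<omega>. (\<omega>, x)))"

definition next_state :: "(nat \<Rightarrow> 'e) \<times> 'm \<Rightarrow> 'e \<times> 'm" where
  "next_state = (\<lambda>(\<omega>, x). (\<omega> 0, f (\<omega> 0) x))"

lemma measurable_fibre_map [measurable (raw)]:
  assumes "a \<in> N \<rightarrow>\<^sub>M E" "b \<in> N \<rightarrow>\<^sub>M M"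
  shows "(\<lambda>y. f (a y) (b y)) \<in> N \<rightarrow>\<^sub>M M"
  using measurable_compose[OF measurable_Pair[OF assms] measurable_f] by (simp only: prod.case)

lemma measurable_p_hat: "p_hat E M p f \<in> E \<Otimes>\<^sub>M M \<rightarrow>\<^sub>M prob_algebra (E \<Otimes>\<^sub>M M)"
  unfolding p_hat_def case_prod_beta'
  by (rule measurable_distr_prob_space2[OF measurable_compose[OF measurable_fst kernel]])
     (simp add: case_prod_beta')

lemma measurable_trajectory: "trajectory \<in> E \<Otimes>\<^sub>M M \<rightarrow>\<^sub>M prob_algebra phase"
  unfolding trajectory_def case_prod_beta'
  by (rule measurable_distr_prob_space2[OF measurable_compose[OF measurable_fst path_kernel]])
     (simp add: case_prod_beta')

lemma measurable_next_state: "next_state \<in> phase \<rightarrow>\<^sub>M E \<Otimes>\<^sub>M M"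
  unfolding next_state_def case_prod_beta' by measurable

lemma measurable_skew_product: "skew_product f \<in> phase \<rightarrow>\<^sub>M phase"
  unfolding skew_product_def case_prod_beta'
  by (intro measurable_Pair measurable_compose[OF measurable_fst measurable_shift_paths]) measurable

lemma nn_integral_p_hat:
  assumes z: "z \<in> space (E \<Otimes>\<^sub>M M)" and "g \<in> borel_measurable (E \<Otimes>\<^sub>M M)"
  shows "(\<integral>\<^sup>+w. g w \<partial>p_hat E M p f z) = (\<integral>\<^sup>+\<beta>. g (\<beta>, f \<beta> (snd z)) \<partial>p (fst z))"
proof -
  have [simp]: "fst z \<in> space E" "snd z \<in> space M"
    using z by (auto simp: space_pair_measure)
  show ?thesis
    unfolding p_hat_def case_prod_beta'
    using assms(2) by (intro nn_integral_distr) (simp_all add: subprob_measurableD[OF kernel_subprob])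
qed

lemma nn_integral_trajectory:
  assumes z: "z \<in> space (E \<Otimes>\<^sub>M M)" and "g \<in> borel_measurable phase"
  shows "(\<integral>\<^sup>+y. g y \<partial>trajectory z) = (\<integral>\<^sup>+\<omega>. g (\<omega>, snd z) \<partial>path_kernel (fst z))"
proof -
  have [simp]: "fst z \<in> space E" "snd z \<in> space M"
    using z by (auto simp: space_pair_measure)
  show ?thesis
    unfolding trajectory_def case_prod_beta'
    using assms(2) by (intro nn_integral_distr) (simp_all add: subprob_measurableD[OF path_kernel_subprob])
qed

text \<open>
  The Markov property of the trajectory reduces to that of the path of letters: the letter \<open>\<beta>\<close> at time 1
  has law \<open>p \<alpha>\<close>, the point moves from \<open>x\<close> to \<open>f \<beta> x\<close>, and the remaining letters have law
  \<open>path_kernel \<beta>\<close>.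
\<close>
sublocale trajectory_kernel "E \<Otimes>\<^sub>M M" phase "p_hat E M p f" trajectory "skew_product f" next_state
proof
  fix z and g :: "('e \<times> 'm) \<times> ((nat \<Rightarrow> 'e) \<times> 'm) \<Rightarrow> ennreal"
  assume z: "z \<in> space (E \<Otimes>\<^sub>M M)" and g [measurable]: "g \<in> borel_measurable ((E \<Otimes>\<^sub>M M) \<Otimes>\<^sub>M phase)"
  obtain \<alpha> x where z_eq: "z = (\<alpha>, x)" by (cases z)
  have [simp]: "\<alpha> \<in> space E" "x \<in> space M"
    using z by (auto simp: space_pair_measure z_eq)
  note [measurable] = measurable_skew_product measurable_next_state measurable_prob_algebraD[OF measurable_trajectory]
  have "(\<integral>\<^sup>+y. g (next_state y, skew_product f y) \<partial>trajectory z)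
      = (\<integral>\<^sup>+\<omega>. g (next_state (\<omega>, x), skew_product f (\<omega>, x)) \<partial>path_kernel \<alpha>)"
    using nn_integral_trajectory[OF z, of "\<lambda>y. g (next_state y, skew_product f y)"] by (simp add: z_eq)
  also have "\<dots> = (\<integral>\<^sup>+\<beta>. \<integral>\<^sup>+\<omega>. g (next_state (case_nat \<beta> \<omega>, x), skew_product f (case_nat \<beta> \<omega>, x)) \<partial>path_kernel \<beta> \<partial>p \<alpha>)"
    by (rule nn_integral_path_kernel) simp_all
  also have "\<dots> = (\<integral>\<^sup>+\<beta>. \<integral>\<^sup>+\<omega>. g ((\<beta>, f \<beta> x), (\<omega>, f \<beta> x)) \<partial>path_kernel \<beta> \<partial>p \<alpha>)"
    by (simp add: next_state_def skew_product_def)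
  also have "\<dots> = (\<integral>\<^sup>+\<beta>. \<integral>\<^sup>+y. g ((\<beta>, f \<beta> x), y) \<partial>trajectory (\<beta>, f \<beta> x) \<partial>p \<alpha>)"
  proof (rule nn_integral_cong)
    fix \<beta> assume "\<beta> \<in> space (p \<alpha>)"
    then have [simp]: "\<beta> \<in> space E" by (simp add: subprob_measurableD[OF kernel_subprob])
    then have "(\<beta>, f \<beta> x) \<in> space (E \<Otimes>\<^sub>M M)"
      using measurable_space[OF measurable_f, of "(\<beta>, x)"] by (simp add: space_pair_measure)
    then show "(\<integral>\<^sup>+\<omega>. g ((\<beta>, f \<beta> x), (\<omega>, f \<beta> x)) \<partial>path_kernel \<beta>)
        = (\<integral>\<^sup>+y. g ((\<beta>, f \<beta> x), y) \<partial>trajectory (\<beta>, f \<beta> x))"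
      by (subst nn_integral_trajectory) simp_all
  qed
  also have "\<dots> = (\<integral>\<^sup>+w. \<integral>\<^sup>+y. g (w, y) \<partial>trajectory w \<partial>p_hat E M p f z)"
    by (subst nn_integral_p_hat[OF z])
       (simp_all add: z_eq nn_integral_measurable_subprob_algebra2[OF _ measurable_prob_algebraD[OF measurable_trajectory]])
  finally show "(\<integral>\<^sup>+y. g (next_state y, skew_product f y) \<partial>trajectory z) =
      (\<integral>\<^sup>+w. \<integral>\<^sup>+y. g (w, y) \<partial>trajectory w \<partial>p_hat E M p f z)" .
qed (rule measurable_p_hat, rule measurable_trajectory, rule measurable_skew_product, rule measurable_next_state)

lemma emeasure_trajectory_all_paths:
  assumes z: "z \<in> space (E \<Otimes>\<^sub>M M)" and [measurable]: "B \<in> sets M" "A \<in> sets phase"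
  shows "emeasure (trajectory z) ((space paths \<times> B) \<inter> A) = indicator B (snd z) * emeasure (trajectory z) A"
proof -
  have sets: "sets (trajectory z) = sets phase"
    by (rule trajectory_facts[OF z])
  have A: "emeasure (trajectory z) X = (\<integral>\<^sup>+\<omega>. indicator X (\<omega>, snd z) \<partial>path_kernel (fst z))"
    if "X \<in> sets phase" for X
    using nn_integral_trajectory[OF z, of "indicator X"] that by (simp add: sets)
  have z': "fst z \<in> space E" "snd z \<in> space M"
    using z by (auto simp: space_pair_measure)
  have "emeasure (trajectory z) ((space paths \<times> B) \<inter> A)
      = (\<integral>\<^sup>+\<omega>. indicator B (snd z) * indicator A (\<omega>, snd z) \<partial>path_kernel (fst z))"
    by (subst A) (auto intro!: nn_integral_cong simp: subprob_measurableD[OF path_kernel_subprob z'(1)] split: split_indicator)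
  also have "\<dots> = indicator B (snd z) * emeasure (trajectory z) A"
    using z' by (simp add: A nn_integral_cmult subprob_measurableD[OF path_kernel_subprob z'(1)])
  finally show ?thesis .
qed

text \<open>
  Invariance allows testing \<open>A\<close> after the first step, so that step can be integrated out. This is the
  induction step for the independence of \<open>A\<close> from cylinders; taking the whole space for \<open>A\<close> gives the
  corresponding recursion for the cylinder alone.
\<close>
lemma emeasure_trajectory_cylinder_step:
  assumes z: "z \<in> space (E \<Otimes>\<^sub>M M)" and B [measurable]: "B \<in> sets M" and A [measurable]: "A \<in> sets phase"
    and C [measurable]: "\<And>i. C i \<in> sets E"
    and invariant: "skew_product f -` A \<inter> space phase = A"
  shows "emeasure (trajectory z) ((cylinder E (Suc n) C \<times> B) \<inter> A) =
    indicator B (snd z) * (\<integral>\<^sup>+w. indicator (C 0) (fst w) *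
      emeasure (trajectory w) ((cylinder E n (\<lambda>i. C (Suc i)) \<times> space M) \<inter> A) \<partial>p_hat E M p f z)"
proof -
  let ?D = "(cylinder E n (\<lambda>i. C (Suc i)) \<times> space M) \<inter> A"
  have sets: "sets (trajectory z) = sets phase" "space (trajectory z) = space phase" if "z \<in> space (E \<Otimes>\<^sub>M M)" for z
    by (rule trajectory_facts[OF that])+
  obtain \<alpha> x where z_eq: "z = (\<alpha>, x)" by (cases z)
  have \<alpha>: "\<alpha> \<in> space E" and x: "x \<in> space M"
    using z by (auto simp: space_pair_measure z_eq)
  have cyl [measurable]: "cylinder E (Suc n) C \<in> sets paths" "cylinder E n (\<lambda>i. C (Suc i)) \<in> sets paths"
    by (rule sets_cylinder, rule C)+
  have indicator_step: "indicator ((cylinder E (Suc n) C \<times> B) \<inter> A) (\<omega>, x) =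
      (indicator B x * (indicator (C 0) (fst (next_state (\<omega>, x))) * indicator ?D (skew_product f (\<omega>, x))) :: ennreal)"
    if \<omega>: "\<omega> \<in> space paths" for \<omega>
  proof -
    have "(\<omega>, x) \<in> space phase" using \<omega> x by (simp add: space_pair_measure)
    then have "skew_product f (\<omega>, x) \<in> space phase" "skew_product f (\<omega>, x) \<in> A \<longleftrightarrow> (\<omega>, x) \<in> A"
      using invariant measurable_space[OF measurable_skew_product] by auto
    moreover have "\<omega> \<in> cylinder E (Suc n) C \<longleftrightarrow> \<omega> 0 \<in> C 0 \<and> (\<lambda>n. \<omega> (Suc n)) \<in> cylinder E n (\<lambda>i. C (Suc i))"
      using \<omega> measurable_space[OF measurable_shift_paths \<omega>] by (auto simp: cylinder_iff All_less_Suc2)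
    ultimately show ?thesis
      by (auto simp: next_state_def skew_product_def space_pair_measure split: split_indicator)
  qed
  have "emeasure (trajectory z) ((cylinder E (Suc n) C \<times> B) \<inter> A)
      = (\<integral>\<^sup>+\<omega>. indicator ((cylinder E (Suc n) C \<times> B) \<inter> A) (\<omega>, x) \<partial>path_kernel \<alpha>)"
    using nn_integral_trajectory[OF z, of "indicator ((cylinder E (Suc n) C \<times> B) \<inter> A)"]
    by (simp add: sets[OF z, unfolded z_eq] z_eq)
  also have "\<dots> = (\<integral>\<^sup>+\<omega>. indicator B x * (indicator (C 0) (fst (next_state (\<omega>, x))) * indicator ?D (skew_product f (\<omega>, x))) \<partial>path_kernel \<alpha>)"
    using indicator_step by (intro nn_integral_cong) (simp add: subprob_measurableD[OF path_kernel_subprob \<alpha>])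
  also have "\<dots> = (\<integral>\<^sup>+y. indicator B x * (indicator (C 0) (fst (next_state y)) * indicator ?D (skew_product f y)) \<partial>trajectory z)"
    by (subst nn_integral_trajectory[OF z]) (simp_all add: z_eq)
  also have "\<dots> = indicator B x * (\<integral>\<^sup>+y. indicator (C 0) (fst (next_state y)) * indicator ?D (skew_product f y) \<partial>trajectory z)"
    by (rule nn_integral_cmult) (simp add: measurable_trajectory_eq[OF z])
  also have "(\<integral>\<^sup>+y. indicator (C 0) (fst (next_state y)) * indicator ?D (skew_product f y) \<partial>trajectory z)
      = (\<integral>\<^sup>+w. \<integral>\<^sup>+y. indicator (C 0) (fst w) * indicator ?D y \<partial>trajectory w \<partial>p_hat E M p f z)"
    using first_step[OF z, of "\<lambda>u. indicator (C 0) (fst (fst u)) * indicator ?D (snd u)"] by simp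
  also have "\<dots> = (\<integral>\<^sup>+w. indicator (C 0) (fst w) * emeasure (trajectory w) ?D \<partial>p_hat E M p f z)"
  proof (rule nn_integral_cong)
    fix w assume "w \<in> space (p_hat E M p f z)"
    then have w: "w \<in> space (E \<Otimes>\<^sub>M M)" by (simp add: chain_facts[OF z])
    have "(\<integral>\<^sup>+y. indicator (C 0) (fst w) * indicator ?D y \<partial>trajectory w)
        = indicator (C 0) (fst w) * (\<integral>\<^sup>+y. indicator ?D y \<partial>trajectory w)"
      by (rule nn_integral_cmult) (simp add: measurable_trajectory_eq[OF w])
    then show "(\<integral>\<^sup>+y. indicator (C 0) (fst w) * indicator ?D y \<partial>trajectory w)
        = indicator (C 0) (fst w) * emeasure (trajectory w) ?D"
      by (simp only: nn_integral_indicator sets[OF w] sets.Int pair_measureI cyl A sets.top)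
  qed
  finally show ?thesis by (simp add: z_eq)
qed

text \<open>
  The statement holds for almost every starting state \<open>z\<close>, which is the right form for the induction on
  the length of the cylinder: by stationarity, almost every \<open>z\<close> moves almost surely to a state for which
  the induction hypothesis holds.
\<close>
lemma AE_invariant_set_independent_of_cylinder:
  assumes \<nu>: "stationary (E \<Otimes>\<^sub>M M) (p_hat E M p f) \<nu>"
    and A [measurable]: "A \<in> sets phase" and invariant: "skew_product f -` A \<inter> space phase = A"
    and c: "AE z in \<nu>. emeasure (trajectory z) A = c"
    and "\<And>i. C i \<in> sets E" and "B \<in> sets M"
  shows "AE z in \<nu>. emeasure (trajectory z) ((cylinder E n C \<times> B) \<inter> A)
    = c * emeasure (trajectory z) (cylinder E n C \<times> B)"
  using assms(5,6)
proof (induction n arbitrary: C B)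
  case 0
  have cyl: "cylinder E 0 C = space paths" by (rule set_eqI) (simp only: cylinder_iff, simp)
  from c AE_space show ?case
  proof eventually_elim
    fix z assume "z \<in> space \<nu>" and zc: "emeasure (trajectory z) A = c"
    then have z: "z \<in> space (E \<Otimes>\<^sub>M M)" by (simp add: stationary_facts[OF chain \<nu>])
    have "space paths \<times> B \<inter> space phase = space paths \<times> B"
      using sets.sets_into_space[OF 0(2)] by (auto simp: space_pair_measure)
    moreover have "emeasure (trajectory z) (space phase) = 1"
      using prob_space.emeasure_space_1[OF trajectory_facts(1)[OF z]] by (simp add: trajectory_facts[OF z])
    ultimately show "emeasure (trajectory z) ((cylinder E 0 C \<times> B) \<inter> A) = c * emeasure (trajectory z) (cylinder E 0 C \<times> B)"
      unfolding cyl
      using emeasure_trajectory_all_paths[OF z 0(2) A] emeasure_trajectory_all_paths[OF z 0(2) sets.top] zc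
      by (simp add: mult.commute)
  qed
next
  case (Suc n)
  note [measurable] = Suc.prems
  let ?D = "cylinder E n (\<lambda>i. C (Suc i)) \<times> space M"
  have cyl [measurable]: "cylinder E n (\<lambda>i. C (Suc i)) \<in> sets paths"
    by (rule sets_cylinder, rule Suc.prems)
  have D: "?D \<inter> space phase = ?D"
    by (auto simp: space_pair_measure cylinder_iff)
  have CB: "(cylinder E (Suc n) C \<times> B) \<inter> space phase = cylinder E (Suc n) C \<times> B"
    using sets.sets_into_space[OF Suc.prems(2)] by (auto simp: space_pair_measure cylinder_iff)
  have whole: "skew_product f -` space phase \<inter> space phase = space phase"
    using measurable_space[OF measurable_skew_product] by auto
  have "AE w in \<nu>. emeasure (trajectory w) (?D \<inter> A) = c * emeasure (trajectory w) ?D"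
    by (rule Suc.IH) (auto intro: Suc.prems)
  then have "AE z in \<nu>. AE w in p_hat E M p f z. emeasure (trajectory w) (?D \<inter> A) = c * emeasure (trajectory w) ?D"
    by (rule AE_stationary[OF chain \<nu>, rotated]) measurable
  from this AE_space show ?case
  proof eventually_elim
    fix z assume "z \<in> space \<nu>"
      and IH: "AE w in p_hat E M p f z. emeasure (trajectory w) (?D \<inter> A) = c * emeasure (trajectory w) ?D"
    then have z: "z \<in> space (E \<Otimes>\<^sub>M M)" by (simp add: stationary_facts[OF chain \<nu>])
    have "(\<integral>\<^sup>+w. indicator (C 0) (fst w) * emeasure (trajectory w) (?D \<inter> A) \<partial>p_hat E M p f z)
        = (\<integral>\<^sup>+w. c * (indicator (C 0) (fst w) * emeasure (trajectory w) ?D) \<partial>p_hat E M p f z)"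
      using IH by (intro nn_integral_cong_AE) (auto simp: mult_ac)
    also have "\<dots> = c * (\<integral>\<^sup>+w. indicator (C 0) (fst w) * emeasure (trajectory w) ?D \<partial>p_hat E M p f z)"
      by (rule nn_integral_cmult) (simp add: measurable_chain_eq[OF z], measurable)
    finally show "emeasure (trajectory z) ((cylinder E (Suc n) C \<times> B) \<inter> A)
        = c * emeasure (trajectory z) (cylinder E (Suc n) C \<times> B)"
      using emeasure_trajectory_cylinder_step[OF z Suc.prems(2) A Suc.prems(1) invariant, of n]
        emeasure_trajectory_cylinder_step[OF z Suc.prems(2) sets.top Suc.prems(1) whole, of n]
      unfolding D CB by (simp add: mult_ac)
  qed
qed

text \<open>
  Independence from cylinders says that the measures with the densities \<open>indicator A\<close> and \<open>c\<close> agree on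
  a generator. They are therefore equal, and evaluating them at \<open>A\<close> itself gives \<open>c = c * c\<close>.
\<close>
lemma lift_ergodic_if_stationary_ergodic:
  assumes ergodic: "ergodic_stationary (E \<Otimes>\<^sub>M M) (p_hat E M p f) \<nu>"
  shows "ergodic_invariant phase (skew_product f) (\<nu> \<bind> trajectory)"
proof -
  have \<nu>: "stationary (E \<Otimes>\<^sub>M M) (p_hat E M p f) \<nu>"
    using ergodic by (simp add: ergodic_stationary_def)
  let ?\<mu> = "\<nu> \<bind> trajectory"
  note \<mu> = lift_facts[OF \<nu>]
  note [measurable_cong] = \<mu>(2)
  interpret \<mu>: prob_space ?\<mu> by (rule \<mu>)
  have "emeasure ?\<mu> A \<in> {0, 1}"
    if A [measurable]: "A \<in> sets phase" and invariant: "skew_product f -` A \<inter> space phase = A" for A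
  proof -
    define c where "c = emeasure ?\<mu> A"
    have c: "AE z in \<nu>. emeasure (trajectory z) A = c"
      unfolding c_def by (rule AE_trajectory_of_invariant_set[OF \<nu> ergodic A invariant])
    have "density ?\<mu> (indicator A) = density ?\<mu> (\<lambda>_. c)"
    proof (rule measure_eqI_cylinder_rectangles)
      show "finite_measure (density ?\<mu> (indicator A))"
        by (rule \<mu>.finite_measure_restricted) (simp add: \<mu>)
      fix n and C :: "nat \<Rightarrow> 'e set" and B assume C: "\<And>i. C i \<in> sets E" and B: "B \<in> sets M"
      let ?R = "cylinder E (Suc n) C \<times> B"
      have R [measurable]: "?R \<in> sets phase"
        using B by (intro pair_measureI sets_cylinder C)
      have "emeasure (density ?\<mu> (indicator A)) ?R = emeasure ?\<mu> (?R \<inter> A)"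
        by (subst emeasure_restricted) (simp_all add: Int_commute)
      also have "\<dots> = (\<integral>\<^sup>+z. emeasure (trajectory z) (?R \<inter> A) \<partial>\<nu>)"
        by (rule emeasure_bind_prob_algebra[OF \<nu>_in_space[OF \<nu>] trajectory]) simp
      also have "\<dots> = (\<integral>\<^sup>+z. c * emeasure (trajectory z) ?R \<partial>\<nu>)"
        by (rule nn_integral_cong_AE) (rule AE_invariant_set_independent_of_cylinder[OF \<nu> A invariant c C B])
      also have "\<dots> = c * (\<integral>\<^sup>+z. emeasure (trajectory z) ?R \<partial>\<nu>)"
        by (rule nn_integral_cmult) (simp add: measurable_cong_sets[OF stationary_facts(3)[OF chain \<nu>] refl])
      also have "\<dots> = c * emeasure ?\<mu> ?R"
        by (simp add: emeasure_bind_prob_algebra[OF \<nu>_in_space[OF \<nu>] trajectory])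
      also have "\<dots> = emeasure (density ?\<mu> (\<lambda>_. c)) ?R"
        by (simp add: emeasure_density_const \<mu>)
      finally show "emeasure (density ?\<mu> (indicator A)) ?R = emeasure (density ?\<mu> (\<lambda>_. c)) ?R" .
    qed (simp_all add: \<mu>)
    then have "emeasure (density ?\<mu> (indicator A)) A = emeasure (density ?\<mu> (\<lambda>_. c)) A" by simp
    then have "c = c * c"
      by (subst (asm) emeasure_restricted) (simp_all add: emeasure_density_const \<mu> c_def)
    moreover have "c = ennreal (measure ?\<mu> A)"
      by (simp add: c_def \<mu>.emeasure_eq_measure)
    ultimately have "measure ?\<mu> A = measure ?\<mu> A * measure ?\<mu> A"
      by (simp add: ennreal_mult[symmetric])
    then have "measure ?\<mu> A = 0 \<or> measure ?\<mu> A = 1" by simp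
    then show ?thesis by (auto simp: \<mu>.emeasure_eq_measure)
  qed
  then show ?thesis
    using lift_in_space[OF \<nu>] lift_invariant[OF \<nu>] measurable_skew_product
    by (simp add: ergodic_invariant_def)
qed

lemma ergodic_lift_iff:
  assumes "stationary (E \<Otimes>\<^sub>M M) (p_hat E M p f) \<nu>"
  shows "ergodic_stationary (E \<Otimes>\<^sub>M M) (p_hat E M p f) \<nu> \<longleftrightarrow>
    ergodic_invariant phase (skew_product f) (\<nu> \<bind> trajectory)"
  using lift_ergodic_if_stationary_ergodic stationary_ergodic_if_lift_ergodic[OF assms] by blast

end

section \<open>Disintegrations of stationary measures and their lifts\<close>

text \<open>
  Duality says that \<open>p\<close> and \<open>q\<close> are the two disintegrations of one measure on \<open>E \<times> E\<close>, the law of two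
  consecutive states of the stationary chain.
\<close>
lemma nn_integral_dual_kernel:
  assumes p: "p \<in> E \<rightarrow>\<^sub>M prob_algebra E" and m: "m \<in> space (prob_algebra E)"
    and q: "dual_kernel E p m q" and [measurable]: "g \<in> borel_measurable (E \<Otimes>\<^sub>M E)"
  shows "(\<integral>\<^sup>+\<alpha>. \<integral>\<^sup>+\<beta>. g (\<alpha>, \<beta>) \<partial>p \<alpha> \<partial>m) = (\<integral>\<^sup>+\<beta>. \<integral>\<^sup>+\<alpha>. g (\<alpha>, \<beta>) \<partial>q \<beta> \<partial>m)"
proof -
  have prob: "prob_space m" and sets [measurable_cong]: "sets m = sets E"
    using m by (auto simp: space_prob_algebra)
  have p': "p \<in> m \<rightarrow>\<^sub>M prob_algebra E" and q': "q \<in> m \<rightarrow>\<^sub>M prob_algebra E"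
    using p q by (simp_all add: dual_kernel_def measurable_cong_sets[OF sets refl])
  let ?P = "semidirect_product m E p" and ?Q = "semidirect_product m E q"
  note [measurable_cong] = sets_semidirect_product[OF prob p'] sets_semidirect_product[OF prob q']
  have "?P = distr ?Q (E \<Otimes>\<^sub>M E) (\<lambda>(\<beta>, \<alpha>). (\<alpha>, \<beta>))"
  proof (rule measure_eqI_rectangles)
    show "sets ?P = sets (E \<Otimes>\<^sub>M E)"
      unfolding sets_semidirect_product[OF prob p'] by (rule sets_pair_measure_cong[OF sets refl])
    show "finite_measure ?P"
      by (intro prob_space.finite_measure prob_space_semidirect_product prob p')
    fix B A assume [measurable]: "B \<in> sets E" "A \<in> sets E"
    have "emeasure ?P (B \<times> A) = (\<integral>\<^sup>+\<alpha>\<in>B. emeasure (p \<alpha>) A \<partial>m)"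
      by (rule emeasure_semidirect_product_rectangle[OF prob p']) (simp_all add: sets)
    also have "\<dots> = (\<integral>\<^sup>+\<beta>\<in>A. emeasure (q \<beta>) B \<partial>m)"
      using q by (simp add: dual_kernel_def)
    also have "\<dots> = emeasure ?Q (A \<times> B)"
      by (rule emeasure_semidirect_product_rectangle[OF prob q', symmetric]) (simp_all add: sets)
    also have "A \<times> B = (\<lambda>(\<beta>, \<alpha>). (\<alpha>, \<beta>)) -` (B \<times> A) \<inter> space ?Q"
      using sets.sets_into_space[of A E] sets.sets_into_space[of B E]
      by (auto simp: sets_eq_imp_space_eq[OF sets_semidirect_product[OF prob q']] space_pair_measure
          sets_eq_imp_space_eq[OF sets])
    finally show "emeasure ?P (B \<times> A) = emeasure (distr ?Q (E \<Otimes>\<^sub>M E) (\<lambda>(\<beta>, \<alpha>). (\<alpha>, \<beta>))) (B \<times> A)"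
      by (subst emeasure_distr) simp_all
  qed simp
  then have "(\<integral>\<^sup>+x. g x \<partial>?P) = (\<integral>\<^sup>+x. g (case x of (\<beta>, \<alpha>) \<Rightarrow> (\<alpha>, \<beta>)) \<partial>?Q)"
    by (simp add: nn_integral_distr)
  then show ?thesis
    by (simp add: nn_integral_semidirect_product[OF prob p'] nn_integral_semidirect_product[OF prob q'])
qed

text \<open>
  Let \<open>z\<close> have law \<open>\<nu>\<close>, let \<open>\<beta>\<close> have law \<open>P z\<close>, and let \<open>\<mu>\<close> be the law of \<open>(\<beta>, g z \<beta>)\<close>. As each
  \<open>P z\<close> is absolutely continuous with respect to \<open>m\<close>, the joint law of \<open>(z, \<beta>)\<close> has a density \<open>h\<close> with respect
  to \<open>\<nu> \<otimes> m\<close>. By Fubini, the conditional law of \<open>g z \<beta>\<close> given \<open>\<beta>\<close> is the image under \<open>\<lambda>z. g z \<beta>\<close> of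
  the measure with density \<open>\<lambda>z. h (z, \<beta>)\<close>. All conditional laws thus come from a single Radon-Nikodym
  derivative. They have total mass 1 for almost every \<open>\<beta>\<close> because \<open>\<mu>\<close> has the first marginal \<open>m\<close>.
\<close>
lemma disintegration_of_absolutely_continuous_kernel:
  fixes Z :: "'z measure" and E :: "'e measure" and M :: "'m measure"
  assumes \<nu>: "\<nu> \<in> space (prob_algebra Z)" and m: "m \<in> space (prob_algebra E)"
    and P: "P \<in> Z \<rightarrow>\<^sub>M prob_algebra E"
    and ac: "\<And>z. z \<in> space Z \<Longrightarrow> absolutely_continuous m (P z)"
    and g [measurable]: "(\<lambda>(z, \<beta>). g z \<beta>) \<in> Z \<Otimes>\<^sub>M E \<rightarrow>\<^sub>M M"
    and \<mu>: "sets \<mu> = sets (E \<Otimes>\<^sub>M M)"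
    and law: "\<And>A B. A \<in> sets E \<Longrightarrow> B \<in> sets M \<Longrightarrow>
      emeasure \<mu> (A \<times> B) = (\<integral>\<^sup>+z. \<integral>\<^sup>+\<beta>. indicator A \<beta> * indicator B (g z \<beta>) \<partial>P z \<partial>\<nu>)"
    and marginal: "\<And>A. A \<in> sets E \<Longrightarrow> emeasure \<mu> (A \<times> space M) = emeasure m A"
  shows "\<exists>\<kappa>. disintegration m M \<mu> \<kappa>"
proof -
  have prob: "prob_space \<nu>" "prob_space m"
    and sets: "sets \<nu> = sets Z" "sets m = sets E"
    using \<nu> m by (auto simp: space_prob_algebra)
  note [measurable_cong] = sets
  interpret \<nu>: prob_space \<nu> by fact
  interpret m: prob_space m by fact
  interpret pair_prob_space \<nu> m ..
  have space: "space \<nu> = space Z" "space m = space E"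
    using sets by (auto dest: sets_eq_imp_space_eq)
  have P': "P \<in> \<nu> \<rightarrow>\<^sub>M prob_algebra m"
    using P by (simp add: measurable_cong_sets[OF sets(1) refl] prob_algebra_cong[OF sets(2)])
  let ?L = "semidirect_product \<nu> m P"
  note L = nn_integral_semidirect_product[OF prob(1) P']
  have sets_L: "sets ?L = sets (\<nu> \<Otimes>\<^sub>M m)"
    by (rule sets_semidirect_product[OF prob(1) P'])
  have "absolutely_continuous (\<nu> \<Otimes>\<^sub>M m) ?L"
    unfolding absolutely_continuous_def
  proof
    fix D assume D: "D \<in> null_sets (\<nu> \<Otimes>\<^sub>M m)"
    then have [measurable]: "D \<in> sets (\<nu> \<Otimes>\<^sub>M m)" by auto
    have "AE z in \<nu>. emeasure m (Pair z -` D) = 0"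
      using D by (subst nn_integral_0_iff_AE[symmetric])
        (auto simp: m.emeasure_pair_measure_alt[symmetric] intro!: m.measurable_emeasure_Pair)
    then have "AE z in \<nu>. (\<integral>\<^sup>+\<beta>. indicator D (z, \<beta>) \<partial>P z) = 0"
    proof (rule AE_mp, intro AE_I2 impI)
      fix z assume z: "z \<in> space \<nu>" and "emeasure m (Pair z -` D) = 0"
      moreover have "Pair z -` D \<in> sets m"
        by (rule sets_Pair1) fact
      ultimately have "Pair z -` D \<in> null_sets m"
        by (simp add: null_sets_def)
      then have "Pair z -` D \<in> null_sets (P z)"
        using ac[of z] z by (auto simp: absolutely_continuous_def space)
      then show "(\<integral>\<^sup>+\<beta>. indicator D (z, \<beta>) \<partial>P z) = 0"
        using nn_integral_indicator[of "Pair z -` D" "P z"]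
        by (simp add: null_setsD1 null_setsD2 indicator_def)
    qed
    then have "emeasure ?L D = 0"
      using L[of "indicator D"] by (simp add: nn_integral_0_iff_AE sets_L cong: nn_integral_cong_AE)
    then show "D \<in> null_sets ?L"
      by (simp add: null_sets_def sets_L)
  qed
  then obtain h where [measurable]: "h \<in> borel_measurable (\<nu> \<Otimes>\<^sub>M m)" and h: "density (\<nu> \<Otimes>\<^sub>M m) h = ?L"
    using Radon_Nikodym[OF _ sets_L] by auto
  define \<kappa>\<^sub>0 where "\<kappa>\<^sub>0 \<beta> = distr (density \<nu> (\<lambda>z. h (z, \<beta>))) M (\<lambda>z. g z \<beta>)" for \<beta>
  have g\<beta> [measurable]: "(\<lambda>z. g z \<beta>) \<in> Z \<rightarrow>\<^sub>M M" if "\<beta> \<in> space E" for \<beta>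
    using measurable_compose[OF measurable_Pair2'[OF that] g] by simp
  have h\<beta> [measurable]: "(\<lambda>z. h (z, \<beta>)) \<in> borel_measurable Z" if "\<beta> \<in> space E" for \<beta>
    using that by (intro measurable_compose[OF measurable_Pair2']) (auto simp: measurable_cong_sets[OF sets(1) refl])
  have \<kappa>\<^sub>0: "emeasure (\<kappa>\<^sub>0 \<beta>) B = (\<integral>\<^sup>+z. h (z, \<beta>) * indicator B (g z \<beta>) \<partial>\<nu>)"
    if [measurable]: "B \<in> sets M" "\<beta> \<in> space E" for \<beta> B
    unfolding \<kappa>\<^sub>0_def
    by (subst emeasure_distr) (auto simp: emeasure_density intro!: nn_integral_cong split: split_indicator)
  have [measurable]: "(\<lambda>\<beta>. emeasure (\<kappa>\<^sub>0 \<beta>) B) \<in> borel_measurable E" if [measurable]: "B \<in> sets M" for B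
    by (subst measurable_cong[OF \<kappa>\<^sub>0[OF that]]) measurable
  have \<kappa>\<^sub>0_rect: "(\<integral>\<^sup>+\<beta>\<in>A. emeasure (\<kappa>\<^sub>0 \<beta>) B \<partial>m) = emeasure \<mu> (A \<times> B)"
    if [measurable]: "A \<in> sets E" "B \<in> sets M" for A B
  proof -
    have "(\<integral>\<^sup>+\<beta>\<in>A. emeasure (\<kappa>\<^sub>0 \<beta>) B \<partial>m)
        = (\<integral>\<^sup>+\<beta>. \<integral>\<^sup>+z. h (z, \<beta>) * (indicator A \<beta> * indicator B (g z \<beta>)) \<partial>\<nu> \<partial>m)"
      by (intro nn_integral_cong)
         (auto simp: \<kappa>\<^sub>0 space split: split_indicator)
    also have "\<dots> = (\<integral>\<^sup>+x. h x * (indicator A (snd x) * indicator B (g (fst x) (snd x))) \<partial>(\<nu> \<Otimes>\<^sub>M m))"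
      by (subst nn_integral_snd[symmetric]) auto
    also have "\<dots> = (\<integral>\<^sup>+x. indicator A (snd x) * indicator B (g (fst x) (snd x)) \<partial>?L)"
      unfolding h[symmetric] by (subst nn_integral_density) auto
    also have "\<dots> = emeasure \<mu> (A \<times> B)"
      by (simp add: L law)
    finally show ?thesis .
  qed
  have "density m (\<lambda>\<beta>. emeasure (\<kappa>\<^sub>0 \<beta>) (space M)) = density m (\<lambda>_. 1)"
    by (rule measure_eqI) (auto simp: emeasure_density \<kappa>\<^sub>0_rect marginal sets)
  then have \<kappa>\<^sub>0_prob: "AE \<beta> in m. emeasure (\<kappa>\<^sub>0 \<beta>) (space M) = 1"
    by (subst (asm) m.density_unique_iff) auto
  obtain x\<^sub>0 where x\<^sub>0: "x\<^sub>0 \<in> space M"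
  proof -
    have "emeasure \<mu> (space E \<times> space M) = 1"
      using marginal[of "space E"] m.emeasure_space_1 by (simp add: space)
    then have "space M \<noteq> {}" by auto
    then show thesis using that by auto
  qed
  \<comment> \<open>On the null set where \<open>\<kappa>\<^sub>0 \<beta>\<close> is not a probability measure, any fixed one will do.\<close>
  define \<kappa> where "\<kappa> \<beta> = (if emeasure (\<kappa>\<^sub>0 \<beta>) (space M) = 1 then \<kappa>\<^sub>0 \<beta> else return M x\<^sub>0)" for \<beta>
  have prob_\<kappa>: "prob_space (\<kappa> \<beta>)" for \<beta>
    by (auto simp: \<kappa>_def prob_space_return x\<^sub>0 \<kappa>\<^sub>0_def intro!: prob_spaceI)
  have "\<kappa> \<in> m \<rightarrow>\<^sub>M prob_algebra M"
  proof (intro measurable_prob_algebraI measurable_subprob_algebra prob_\<kappa> prob_space_imp_subprob_space)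
    show "sets (\<kappa> \<beta>) = sets M" for \<beta>
      by (simp add: \<kappa>_def \<kappa>\<^sub>0_def)
    show "(\<lambda>\<beta>. emeasure (\<kappa> \<beta>) B) \<in> borel_measurable m" if [measurable]: "B \<in> sets M" for B
      unfolding \<kappa>_def if_distrib[of "\<lambda>N. emeasure N B"] by measurable
  qed
  moreover have "(\<integral>\<^sup>+\<beta>\<in>A. emeasure (\<kappa> \<beta>) B \<partial>m) = emeasure \<mu> (A \<times> B)"
    if "A \<in> sets m" "B \<in> sets M" for A B
  proof -
    have "(\<integral>\<^sup>+\<beta>\<in>A. emeasure (\<kappa> \<beta>) B \<partial>m) = (\<integral>\<^sup>+\<beta>\<in>A. emeasure (\<kappa>\<^sub>0 \<beta>) B \<partial>m)"
      using \<kappa>\<^sub>0_prob by (intro nn_integral_cong_AE) (auto simp: \<kappa>_def)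
    with \<kappa>\<^sub>0_rect that show ?thesis by (simp add: sets)
  qed
  ultimately have "disintegration m M \<mu> \<kappa>"
    using \<mu> by (simp add: disintegration_def sets_pair_measure_cong[OF sets(2) refl])
  then show ?thesis by blast
qed
lemma measurable_bind_first_letter:
  assumes "q \<in> E \<rightarrow>\<^sub>M prob_algebra E" and "\<kappa> \<in> E \<rightarrow>\<^sub>M prob_algebra M"
  shows "(\<lambda>\<omega>. q (\<omega> (0::nat)) \<bind> \<kappa>) \<in> PiM UNIV (\<lambda>_. E) \<rightarrow>\<^sub>M prob_algebra M"
  by (rule measurable_bind_prob_space[OF measurable_compose[OF _ assms(1)] assms(2)]) simp

context random_iteration
begin

text \<open>The letters of the chain \<open>p_hat\<close> form a chain with kernel \<open>p\<close>, whatever the fibre component does.\<close>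
lemma first_marginal_stationary:
  assumes \<nu>: "stationary (E \<Otimes>\<^sub>M M) (p_hat E M p f) \<nu>"
  shows "stationary E p (distr \<nu> E fst)"
  unfolding stationary_def
proof (intro conjI ballI)
  note \<nu>_facts = stationary_facts[OF chain \<nu>]
  interpret \<nu>: prob_space \<nu> by (rule \<nu>_facts)
  have fst: "fst \<in> \<nu> \<rightarrow>\<^sub>M E"
    by (simp add: measurable_cong_sets[OF \<nu>_facts(3) refl])
  show "distr \<nu> E fst \<in> space (prob_algebra E)"
    using \<nu>.prob_space_distr[OF fst] by (simp add: space_prob_algebra)
  fix A assume A [measurable]: "A \<in> sets E"
  have "emeasure (distr \<nu> E fst) A = (\<integral>\<^sup>+\<alpha>. indicator A \<alpha> \<partial>distr \<nu> E fst)"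
    using A by simp
  also have "\<dots> = (\<integral>\<^sup>+z. indicator A (fst z) \<partial>\<nu>)"
    by (rule nn_integral_distr[OF fst]) simp
  also have "\<dots> = (\<integral>\<^sup>+z. \<integral>\<^sup>+w. indicator A (fst w) \<partial>p_hat E M p f z \<partial>\<nu>)"
    by (rule nn_integral_stationary[OF chain \<nu>, symmetric]) simp
  also have "\<dots> = (\<integral>\<^sup>+z. emeasure (p (fst z)) A \<partial>\<nu>)"
  proof (rule nn_integral_cong)
    fix z assume "z \<in> space \<nu>"
    then have z: "z \<in> space (E \<Otimes>\<^sub>M M)" by (simp add: \<nu>_facts)
    then have "fst z \<in> space E" by (auto simp: space_pair_measure)
    then show "(\<integral>\<^sup>+w. indicator A (fst w) \<partial>p_hat E M p f z) = emeasure (p (fst z)) A"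
      using nn_integral_p_hat[OF z, of "\<lambda>w. indicator A (fst w)"]
      by (simp add: subprob_measurableD[OF kernel_subprob])
  qed
  also have "\<dots> = (\<integral>\<^sup>+\<alpha>. emeasure (p \<alpha>) A \<partial>distr \<nu> E fst)"
    by (rule nn_integral_distr[OF fst, where f="\<lambda>\<alpha>. emeasure (p \<alpha>) A", symmetric]) simp
  finally show "emeasure (distr \<nu> E fst) A = (\<integral>\<^sup>+\<alpha>. emeasure (p \<alpha>) A \<partial>distr \<nu> E fst)" .
qed

text \<open>
  By stationarity \<open>\<nu>\<close> is the law of the state \<open>(\<beta>, f \<beta> x)\<close> after one step from a state \<open>(\<alpha>, x)\<close> with
  law \<open>\<nu>\<close>, which is the situation of \<open>disintegration_of_absolutely_continuous_kernel\<close>.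
\<close>
lemma disintegration_exists:
  assumes \<nu>: "stationary (E \<Otimes>\<^sub>M M) (p_hat E M p f) \<nu>"
    and m: "m \<in> space (prob_algebra E)" and marginal: "distr \<nu> E fst = m"
    and ac: "\<And>\<alpha>. \<alpha> \<in> space E \<Longrightarrow> absolutely_continuous m (p \<alpha>)"
  shows "\<exists>\<kappa>. disintegration m M \<nu> \<kappa>"
proof (rule disintegration_of_absolutely_continuous_kernel[where Z="E \<Otimes>\<^sub>M M" and P="\<lambda>z. p (fst z)" and g="\<lambda>z \<beta>. f \<beta> (snd z)" and \<nu>=\<nu>])
  note \<nu>_facts = stationary_facts[OF chain \<nu>]
  have fst: "fst \<in> \<nu> \<rightarrow>\<^sub>M E"
    by (simp add: measurable_cong_sets[OF \<nu>_facts(3) refl])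
  show "\<nu> \<in> space (prob_algebra (E \<Otimes>\<^sub>M M))" and "sets \<nu> = sets (E \<Otimes>\<^sub>M M)"
    using \<nu> \<nu>_facts by (simp_all add: stationary_def)
  show "m \<in> space (prob_algebra E)" by (rule m)
  show "(\<lambda>z. p (fst z)) \<in> E \<Otimes>\<^sub>M M \<rightarrow>\<^sub>M prob_algebra E"
    by (rule measurable_compose[OF measurable_fst kernel])
  show "(\<lambda>(z, \<beta>). f \<beta> (snd z)) \<in> (E \<Otimes>\<^sub>M M) \<Otimes>\<^sub>M E \<rightarrow>\<^sub>M M"
    unfolding case_prod_beta' by measurable
  show "absolutely_continuous m (p (fst z))" if "z \<in> space (E \<Otimes>\<^sub>M M)" for z
    using that by (intro ac) (auto simp: space_pair_measure)
  fix A assume A [measurable]: "A \<in> sets E"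
  have "emeasure m A = emeasure \<nu> (fst -` A \<inter> space \<nu>)"
    unfolding marginal[symmetric] by (rule emeasure_distr[OF fst A])
  also have "fst -` A \<inter> space \<nu> = A \<times> space M"
    using sets.sets_into_space[OF A] by (auto simp: \<nu>_facts space_pair_measure)
  finally show "emeasure \<nu> (A \<times> space M) = emeasure m A" ..
  fix B assume B [measurable]: "B \<in> sets M"
  have "emeasure \<nu> (A \<times> B) = (\<integral>\<^sup>+z. \<integral>\<^sup>+w. indicator (A \<times> B) w \<partial>p_hat E M p f z \<partial>\<nu>)"
    using nn_integral_stationary[OF chain \<nu>, of "indicator (A \<times> B)"] by (simp add: \<nu>_facts)
  also have "\<dots> = (\<integral>\<^sup>+z. \<integral>\<^sup>+\<beta>. indicator A \<beta> * indicator B (f \<beta> (snd z)) \<partial>p (fst z) \<partial>\<nu>)"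
    by (intro nn_integral_cong) (simp add: nn_integral_p_hat \<nu>_facts indicator_times)
  finally show "emeasure \<nu> (A \<times> B) =
      (\<integral>\<^sup>+z. \<integral>\<^sup>+\<beta>. indicator A \<beta> * indicator B (f \<beta> (snd z)) \<partial>p (fst z) \<partial>\<nu>)" .
qed

text \<open>
  In the lift, \<open>\<alpha>\<close>, \<open>x\<close> and \<open>\<omega>\<close> are drawn in such a way that, given \<open>\<alpha>\<close>, the point \<open>x\<close> has law
  \<open>\<kappa> \<alpha>\<close> and the path \<open>\<omega>\<close> is independent of it. Drawing \<open>\<omega>\<close> first instead, \<open>\<alpha>\<close> has law \<open>q (\<omega> 0)\<close> by
  duality, and \<open>x\<close> has the mixture of the laws \<open>\<kappa> \<alpha>\<close> as its law.
\<close>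
lemma disintegration_lift:
  assumes \<nu>: "stationary (E \<Otimes>\<^sub>M M) (p_hat E M p f) \<nu>"
    and m: "m \<in> space (prob_algebra E)" and q: "dual_kernel E p m q"
    and \<kappa>: "disintegration m M \<nu> \<kappa>"
  shows "disintegration (markov_measure p m) M (\<nu> \<bind> trajectory) (\<lambda>\<omega>. q (\<omega> 0) \<bind> \<kappa>)"
  unfolding disintegration_def
proof (intro conjI ballI)
  have sets_m: "sets m = sets E" and prob_m: "prob_space m"
    using m by (auto simp: space_prob_algebra)
  note sets_P = sets_markov_measure[OF m]
  have space_m: "space m = space E" using sets_m by (rule sets_eq_imp_space_eq)
  have q_meas: "q \<in> E \<rightarrow>\<^sub>M prob_algebra E"
    using q by (simp add: dual_kernel_def)
  have \<kappa>_meas: "\<kappa> \<in> E \<rightarrow>\<^sub>M prob_algebra M"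
    using \<kappa> by (simp add: disintegration_def measurable_cong_sets[OF sets_m refl])
  note [measurable] = measurable_prob_algebraD[OF q_meas] measurable_prob_algebraD[OF \<kappa>_meas]
  show "sets (\<nu> \<bind> trajectory) = sets (markov_measure p m \<Otimes>\<^sub>M M)"
    by (simp add: lift_facts[OF \<nu>] sets_pair_measure_cong[OF sets_P refl])
  show "(\<lambda>\<omega>. q (\<omega> 0) \<bind> \<kappa>) \<in> markov_measure p m \<rightarrow>\<^sub>M prob_algebra M"
    unfolding measurable_cong_sets[OF sets_P refl] by (rule measurable_bind_first_letter[OF q_meas \<kappa>_meas])
  fix A B assume "A \<in> sets (markov_measure p m)" and B [measurable]: "B \<in> sets M"
  then have A [measurable]: "A \<in> sets paths" by (simp add: sets_P)
  let ?w = "\<lambda>\<beta>. emeasure (q \<beta> \<bind> \<kappa>) B"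
  \<comment> \<open>The mass that paths with first letter \<open>\<beta>\<close> give to \<open>A\<close>.\<close>
  define Q where "Q \<beta> = (\<integral>\<^sup>+\<omega>. indicator A (case_nat \<beta> \<omega>) \<partial>path_kernel \<beta>)" for \<beta>
  have [measurable]: "Q \<in> borel_measurable E"
    unfolding Q_def
    by (rule nn_integral_measurable_subprob_algebra2[OF _ path_kernel_subprob]) measurable
  have w_meas: "?w \<in> borel_measurable E"
    using measurable_prob_algebraD[OF measurable_bind_prob_space[OF q_meas \<kappa>_meas]] B
    by (rule measurable_emeasure_kernel)
  have "(\<lambda>\<omega>. ?w (\<omega> 0)) \<in> borel_measurable paths"
    by (rule measurable_compose[OF _ w_meas]) simp
  then have g_meas: "(\<lambda>\<omega>. ?w (\<omega> 0) * indicator A \<omega>) \<in> borel_measurable paths"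
    by (rule borel_measurable_times_ennreal) simp
  have path_A: "emeasure (path_kernel \<alpha>) A = (\<integral>\<^sup>+\<beta>. Q \<beta> \<partial>p \<alpha>)" if "\<alpha> \<in> space E" for \<alpha>
    using nn_integral_path_kernel[OF that, of "indicator A"] A
    by (simp add: Q_def subprob_measurableD[OF path_kernel_subprob that])
  have "emeasure (\<nu> \<bind> trajectory) (A \<times> B) = (\<integral>\<^sup>+z. emeasure (trajectory z) (A \<times> B) \<partial>\<nu>)"
    by (rule emeasure_bind_prob_algebra[OF \<nu>_in_space[OF \<nu>] trajectory]) simp
  also have "\<dots> = (\<integral>\<^sup>+z. emeasure (path_kernel (fst z)) A * indicator B (snd z) \<partial>\<nu>)"
  proof (rule nn_integral_cong)
    fix z assume "z \<in> space \<nu>"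
    then have z: "z \<in> space (E \<Otimes>\<^sub>M M)" by (simp add: stationary_facts[OF chain \<nu>])
    then have "fst z \<in> space E" by (auto simp: space_pair_measure)
    have "emeasure (trajectory z) (A \<times> B) = (\<integral>\<^sup>+\<omega>. indicator (A \<times> B) (\<omega>, snd z) \<partial>path_kernel (fst z))"
      using nn_integral_trajectory[OF z, of "indicator (A \<times> B)"] by (simp add: trajectory_facts[OF z])
    also have "\<dots> = (\<integral>\<^sup>+\<omega>. indicator A \<omega> * indicator B (snd z) \<partial>path_kernel (fst z))"
      by (simp add: indicator_times)
    also have "\<dots> = emeasure (path_kernel (fst z)) A * indicator B (snd z)"
      using \<open>fst z \<in> space E\<close> by (simp add: nn_integral_multc subprob_measurableD[OF path_kernel_subprob])
    finally show "emeasure (trajectory z) (A \<times> B) = emeasure (path_kernel (fst z)) A * indicator B (snd z)" .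
  qed
  also have "\<dots> = (\<integral>\<^sup>+\<alpha>. \<integral>\<^sup>+x. emeasure (path_kernel \<alpha>) A * indicator B x \<partial>\<kappa> \<alpha> \<partial>m)"
    by (subst nn_integral_disintegration[OF prob_m \<kappa>])
       (simp_all add: measurable_cong_sets[OF sets_pair_measure_cong[OF sets_m refl] refl])
  also have "\<dots> = (\<integral>\<^sup>+\<alpha>. \<integral>\<^sup>+\<beta>. emeasure (\<kappa> \<alpha>) B * Q \<beta> \<partial>p \<alpha> \<partial>m)"
  proof (rule nn_integral_cong)
    fix \<alpha> assume "\<alpha> \<in> space m"
    then have \<alpha>: "\<alpha> \<in> space E" by (simp add: space_m)
    have sets_\<kappa>: "sets (\<kappa> \<alpha>) = sets M"
      by (rule sets_kernel[OF measurable_prob_algebraD[OF \<kappa>_meas] \<alpha>])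
    have "(\<integral>\<^sup>+x. emeasure (path_kernel \<alpha>) A * indicator B x \<partial>\<kappa> \<alpha>) = emeasure (path_kernel \<alpha>) A * emeasure (\<kappa> \<alpha>) B"
      by (rule nn_integral_cmult_indicator) (simp add: sets_\<kappa>)
    also have "\<dots> = emeasure (\<kappa> \<alpha>) B * (\<integral>\<^sup>+\<beta>. Q \<beta> \<partial>p \<alpha>)"
      by (simp only: path_A[OF \<alpha>] mult.commute)
    also have "\<dots> = (\<integral>\<^sup>+\<beta>. emeasure (\<kappa> \<alpha>) B * Q \<beta> \<partial>p \<alpha>)"
      using \<alpha> by (intro nn_integral_cmult[symmetric]) (simp add: subprob_measurableD[OF kernel_subprob])
    finally show "(\<integral>\<^sup>+x. emeasure (path_kernel \<alpha>) A * indicator B x \<partial>\<kappa> \<alpha>) = (\<integral>\<^sup>+\<beta>. emeasure (\<kappa> \<alpha>) B * Q \<beta> \<partial>p \<alpha>)" .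
  qed
  also have "\<dots> = (\<integral>\<^sup>+\<beta>. \<integral>\<^sup>+\<alpha>. emeasure (\<kappa> \<alpha>) B * Q \<beta> \<partial>q \<beta> \<partial>m)"
    using nn_integral_dual_kernel[OF kernel m q, of "\<lambda>x. emeasure (\<kappa> (fst x)) B * Q (snd x)"] by simp
  also have "\<dots> = (\<integral>\<^sup>+\<beta>. \<integral>\<^sup>+\<omega>. ?w (case_nat \<beta> \<omega> 0) * indicator A (case_nat \<beta> \<omega>) \<partial>path_kernel \<beta> \<partial>m)"
  proof (rule nn_integral_cong)
    fix \<beta> assume "\<beta> \<in> space m"
    then have \<beta>: "\<beta> \<in> space E" by (simp add: space_m)
    have "(\<integral>\<^sup>+\<alpha>. emeasure (\<kappa> \<alpha>) B * Q \<beta> \<partial>q \<beta>) = (\<integral>\<^sup>+\<alpha>. emeasure (\<kappa> \<alpha>) B \<partial>q \<beta>) * Q \<beta>"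
      using \<beta> by (intro nn_integral_multc) (simp add: subprob_measurableD[OF measurable_prob_algebraD[OF q_meas]])
    also have "(\<integral>\<^sup>+\<alpha>. emeasure (\<kappa> \<alpha>) B \<partial>q \<beta>) = ?w \<beta>"
      by (rule emeasure_bind_prob_algebra[OF measurable_space[OF q_meas \<beta>] \<kappa>_meas B, symmetric])
    also have "?w \<beta> * Q \<beta> = (\<integral>\<^sup>+\<omega>. ?w \<beta> * indicator A (case_nat \<beta> \<omega>) \<partial>path_kernel \<beta>)"
      using \<beta> unfolding Q_def by (intro nn_integral_cmult[symmetric]) (simp add: subprob_measurableD[OF path_kernel_subprob])
    finally show "(\<integral>\<^sup>+\<alpha>. emeasure (\<kappa> \<alpha>) B * Q \<beta> \<partial>q \<beta>)
        = (\<integral>\<^sup>+\<omega>. ?w (case_nat \<beta> \<omega> 0) * indicator A (case_nat \<beta> \<omega>) \<partial>path_kernel \<beta>)" by simp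
  qed
  also have "\<dots> = (\<integral>\<^sup>+\<omega>\<in>A. ?w (\<omega> 0) \<partial>markov_measure p m)"
    by (rule nn_integral_markov_measure[OF m g_meas, symmetric])
  finally show "emeasure (\<nu> \<bind> trajectory) (A \<times> B) = (\<integral>\<^sup>+\<omega>\<in>A. ?w (\<omega> 0) \<partial>markov_measure p m)" .
qed

text \<open>
  The lift does not involve \<open>\<kappa>\<close>. So every disintegration \<open>\<kappa>\<close> of \<open>\<nu>\<close> leads to the same measure,
  and the definite description picks it out.
\<close>
lemma Xi_eq_lift:
  assumes \<nu>: "stationary (E \<Otimes>\<^sub>M M) (p_hat E M p f) \<nu>"
    and m: "m \<in> space (prob_algebra E)" and marginal: "distr \<nu> E fst = m"
    and ac: "\<And>\<alpha>. \<alpha> \<in> space E \<Longrightarrow> absolutely_continuous m (p \<alpha>)"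
    and q: "dual_kernel E p m q"
  shows "Xi M p m q \<nu> = \<nu> \<bind> trajectory"
  unfolding Xi_def
proof (rule the_equality)
  obtain \<kappa> where "disintegration m M \<nu> \<kappa>"
    using disintegration_exists[OF \<nu> m marginal ac] by blast
  with disintegration_lift[OF \<nu> m q this]
  show "\<exists>\<kappa>. disintegration m M \<nu> \<kappa> \<and>
      disintegration (markov_measure p m) M (\<nu> \<bind> trajectory) (\<lambda>\<omega>. q (\<omega> 0) \<bind> \<kappa>)"
    by blast
next
  fix \<mu> assume "\<exists>\<kappa>. disintegration m M \<nu> \<kappa> \<and> disintegration (markov_measure p m) M \<mu> (\<lambda>\<omega>. q (\<omega> 0) \<bind> \<kappa>)"
  then obtain \<kappa> where \<kappa>: "disintegration m M \<nu> \<kappa>"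
    and \<mu>: "disintegration (markov_measure p m) M \<mu> (\<lambda>\<omega>. q (\<omega> 0) \<bind> \<kappa>)" by blast
  have "(\<lambda>\<omega>. q (\<omega> 0) \<bind> \<kappa>) \<in> markov_measure p m \<rightarrow>\<^sub>M prob_algebra M"
    using \<mu> by (simp add: disintegration_def)
  note unique = disintegration_iff_semidirect_product[OF prob_space_markov_measure[OF m] this]
  show "\<mu> = \<nu> \<bind> trajectory"
    using \<mu> disintegration_lift[OF \<nu> m q \<kappa>] unfolding unique by simp
qed

end

theorem theorem2:
  fixes E m :: "'e measure" and M :: "'m measure"
    and p q :: "'e \<Rightarrow> 'e measure"
    and f :: "'e \<Rightarrow> 'm \<Rightarrow> 'm"
    and \<nu> :: "('e \<times> 'm) measure"
  assumes "standard_borel E" and "standard_borel M"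
    and "p \<in> E \<rightarrow>\<^sub>M prob_algebra E"
    and "stationary E p m" and "\<And>m'. stationary E p m' \<Longrightarrow> m' = m"
    and "case_prod f \<in> E \<Otimes>\<^sub>M M \<rightarrow>\<^sub>M M"
    and "bounded_pair E p m"
    and "dual_kernel E p m q"
    and "stationary (E \<Otimes>\<^sub>M M) (p_hat E M p f) \<nu>"
  shows "ergodic_stationary (E \<Otimes>\<^sub>M M) (p_hat E M p f) \<nu> \<longleftrightarrow>
         ergodic_invariant (PiM UNIV (\<lambda>_. E) \<Otimes>\<^sub>M M) (skew_product f) (Xi M p m q \<nu>)"
proof -
  interpret random_iteration E p M f
    using assms(3,6) by unfold_locales
  have "Xi M p m q \<nu> = \<nu> \<bind> trajectory"
  proof (rule Xi_eq_lift[OF assms(9)])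
    show "m \<in> space (prob_algebra E)"
      using assms(4) by (simp add: stationary_def)
    show "distr \<nu> E fst = m"
      by (rule assms(5)[OF first_marginal_stationary[OF assms(9)]])
    show "absolutely_continuous m (p \<alpha>)" if "\<alpha> \<in> space E" for \<alpha>
      using assms(7) that by (simp add: bounded_pair_def)
    show "dual_kernel E p m q" by (rule assms(8))
  qed
  then show ?thesis
    using ergodic_lift_iff[OF assms(9)] by simp
qed

end
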